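(* Consider the source model with edit probability $\delta<\frac12$, in the asymptotic regime described in the context. For any $\gamma\in(\delta,\frac12)$, the performance of variable-length deduplication (VLD) with marker length $M=M(B)$ such that $2^M=\Theta(\log(B/A))$ satisfies $$\mathbb{E}[\mathcal{L}_{VL}(\boldsymbol{s})]\le\left(12e^{-c_M}(c_M+1)+4H(\gamma,\delta)\frac{1+k_1}{k_2}c_M\right)BL\,(1+o(1)),\qquad\text{as }B\to\infty,$$ where $c_M=\frac{\log(B/A)}{H(\gamma,\delta)2^{M+1}}$.
   Context: All logarithms are base 2. $H(p,q)=p\log\frac1q+(1-p)\log\frac1{1-q}$ is the binary cross entropy. Source model. Parameters: positive integers $A,B$, an edit probability $\delta$, and a probability distribution $\mathbb{P}_l$ on the positive integers with mean $L$ and supported in $[L/2,2L]$. Independently for $a=1,\dots,A$, a length $L_a$ is drawn from $\mathbb{P}_l$ and the source symbol $X_a$ is drawn uniformly from $\{0,1\}^{L_a}$. Then, independently for $b=1,\dots,B$, an index $J_b$ is drawn uniformly from $\{1,\dots,A\}$ and the source block $Y_b$ is obtained from $X_{J_b}$ by a $\delta$-edit, i.e. by flipping each bit independently with probability $\delta$. The data stream is $\boldsymbol{s}=Y_1Y_2\cdots Y_B$. Asymptotic regime. $B\to\infty$; $A$ and $L$ are functions of $B$ tending to infinity with $A\le B^{1-k_2}$ for a fixed $0<k_2<1$ and $L=\Theta(B^{k_1})$ for a fixed $k_1>0$; $\delta\in(0,\frac12)$ is constant. Variable-length deduplication (VLD) with marker length $M$. The string $\boldsymbol{s}$ is parsed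 from left to right as $\boldsymbol{s}=\boldsymbol{z}_1\cdots\boldsymbol{z}_C$, where each chunk $\boldsymbol{z}_c$ (except perhaps the last) contains a single occurrence of $0^M$ (the run of $M$ zeros), located at its end. The encoding starts with a prefix-free (Elias gamma) encoding of $|\boldsymbol{s}|$ (at most $2\log|\boldsymbol{s}|+3$ bits). Chunks are then processed in order, starting with an empty dictionary. A chunk different from all previous chunks is encoded as the bit 1 followed by the chunk itself, and is entered into the dictionary. A chunk equal to an earlier one is encoded as the bit 0 followed by a pointer (index) to its dictionary entry; if the current dictionary has size $t$, the pointer takes $\lceil\log t\rceil$ bits (so at most $\log t+1$). $\mathcal{L}_{VL}(\boldsymbol{s})$ is the total number of bits used to encode $\boldsymbol{s}$. *)

theory Defs
  imports "HOL-Probability.Probability" "HOL-Library.Sublist" "HOL-Library.Landau_Symbols"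
begin

section \<open>Source model\<close>

text \<open>Bits are Booleans, with \<^term>\<open>False\<close> for 0 and \<^term>\<open>True\<close> for 1.\<close>

definition cross_entropy :: "real \<Rightarrow> real \<Rightarrow> real" where
  "cross_entropy p q = p * log 2 (1 / q) + (1 - p) * log 2 (1 / (1 - q))"

definition uniform_bits :: "nat \<Rightarrow> bool list pmf" where
  "uniform_bits n = pmf_of_set {xs. length xs = n}"

definition source_symbol :: "nat pmf \<Rightarrow> bool list pmf" where
  "source_symbol P = bind_pmf P uniform_bits"

definition edit :: "real \<Rightarrow> bool list \<Rightarrow> bool list pmf" where
  "edit \<delta> xs =
     map_pmf (\<lambda>flips. map2 (\<noteq>) xs flips) (replicate_pmf (length xs) (bernoulli_pmf \<delta>))"

text \<open>The list \<open>Xs\<close> holds the source symbols, indexed from 0.\<close>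

definition source_block :: "real \<Rightarrow> bool list list \<Rightarrow> bool list pmf" where
  "source_block \<delta> Xs = bind_pmf (pmf_of_set {..<length Xs}) (\<lambda>j. edit \<delta> (Xs ! j))"

definition source_stream :: "nat \<Rightarrow> nat \<Rightarrow> real \<Rightarrow> nat pmf \<Rightarrow> bool list pmf" where
  "source_stream A B \<delta> P =
     bind_pmf (replicate_pmf A (source_symbol P))
       (\<lambda>Xs. map_pmf concat (replicate_pmf B (source_block \<delta> Xs)))"


section \<open>Variable-length deduplication\<close>

text \<open>The accumulator holds the part of the current chunk read so far; a chunk is closed as soon
  as it ends in the marker, so markers are never shared between chunks (a run of \<open>2 * M\<close> zeros
  at the start of a chunk yields two chunks). Only \<open>M > 0\<close> is meaningful.\<close>

primrec chunks_from :: "nat \<Rightarrow> bool list \<Rightarrow> bool list \<Rightarrow> bool list list" where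
  "chunks_from M acc [] = (if acc = [] then [] else [acc])"
| "chunks_from M acc (x # xs) =
     (if suffix (replicate M False) (acc @ [x])
      then (acc @ [x]) # chunks_from M [] xs
      else chunks_from M (acc @ [x]) xs)"

definition vld_chunks :: "nat \<Rightarrow> bool list \<Rightarrow> bool list list" where
  "vld_chunks M s = chunks_from M [] s"

lemma concat_chunks_from: "concat (chunks_from M acc s) = acc @ s"
  by (induction s arbitrary: acc) auto

lemma concat_vld_chunks: "concat (vld_chunks M s) = s"
  by (simp add: vld_chunks_def concat_chunks_from)

lemma chunks_from_eq_Nil_iff: "chunks_from M acc s = [] \<longleftrightarrow> acc = [] \<and> s = []"
  by (induction s arbitrary: acc) auto

lemma chunks_from_markers:
  assumes "M > 0" "\<not> sublist (replicate M False) acc"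
  shows "(\<forall>z \<in> set (butlast (chunks_from M acc s)). suffix (replicate M False) z) \<and>
         (\<forall>z \<in> set (chunks_from M acc s). \<not> sublist (replicate M False) (butlast z))"
  using assms(2)
proof (induction s arbitrary: acc)
  case Nil
  have "sublist (butlast acc) acc"
    by (metis append_butlast_last_id butlast.simps(1) sublist_append_rightI sublist_order.order_refl)
  with Nil show ?case
    by (auto dest: sublist_order.order_trans)
next
  case (Cons x xs)
  have nil: "\<not> sublist (replicate M False) []"
    using assms(1) by simp
  have "\<not> sublist (replicate M False) (acc @ [x])"
    if "\<not> suffix (replicate M False) (acc @ [x])"
    using that Cons.prems by (simp add: sublist_snoc)
  then show ?case
    using Cons.IH[of "[]"] Cons.IH[of "acc @ [x]"] Cons.prems nil
    by auto
qed

lemma vld_chunks_markers: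
  assumes "M > 0"
  shows "z \<in> set (butlast (vld_chunks M s)) \<Longrightarrow> suffix (replicate M False) z"
    and "z \<in> set (vld_chunks M s) \<Longrightarrow> \<not> sublist (replicate M False) (butlast z)"
  using chunks_from_markers[OF assms, of "[]" s] assms by (auto simp: vld_chunks_def)

text \<open>Most significant bit first.\<close>

definition binary :: "nat \<Rightarrow> nat \<Rightarrow> bool list" where
  "binary w n = rev (map (bit n) [0..<w])"

text \<open>Only \<open>n > 0\<close> is meaningful.\<close>

definition elias_gamma :: "nat \<Rightarrow> bool list" where
  "elias_gamma n =
     (let k = nat \<lfloor>log 2 (real n)\<rfloor> in replicate k False @ binary (Suc k) n)"

definition pointer :: "bool list list \<Rightarrow> bool list \<Rightarrow> bool list" where
  "pointer D z =
     binary (nat \<lceil>log 2 (real (length D))\<rceil>) (LEAST i. i < length D \<and> D ! i = z)"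

text \<open>The first list is the current dictionary, in order of insertion.\<close>

primrec encode_chunks :: "bool list list \<Rightarrow> bool list list \<Rightarrow> bool list" where
  "encode_chunks D [] = []"
| "encode_chunks D (z # zs) =
     (if z \<in> set D
      then False # pointer D z @ encode_chunks D zs
      else True # z @ encode_chunks (D @ [z]) zs)"

definition vld_encode :: "nat \<Rightarrow> bool list \<Rightarrow> bool list" where
  "vld_encode M s = elias_gamma (length s) @ encode_chunks [] (vld_chunks M s)"

definition vld_length :: "nat \<Rightarrow> bool list \<Rightarrow> nat" where
  "vld_length M s = length (vld_encode M s)"

end

theory Submission
  imports Defs "HOL-Real_Asymp.Real_Asymp"
begin

text \<open>Put \<open>H = H(\<gamma>, \<delta>)\<close> and let \<open>n\<close> be the least integer above \<open>log (B / A) / H\<close>. Up to \<open>O(n)\<close>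
  bits at the start of each block, the cost of every chunk can be charged to windows of \<open>n + 1\<close> bits
  inside a single block, and a single block is marginally uniform. This gives three main terms.
  Bits of chunks longer than \<open>n\<close> need a window without marker, which has probability about
  \<open>exp (- c\<^sub>M)\<close>. The number of chunks is at most the number of occurrences of the marker, about
  \<open>B L / 2 ^ M\<close>, and each pointer takes at most \<open>(1 + k1) log B + O(1)\<close> bits. New chunks of length
  at most \<open>n\<close> are negligible: those within relative Hamming distance \<open>\<gamma>\<close> of a window of some
  source symbol are few, because \<open>H(\<gamma>, \<gamma>) < H\<close>, and the others are rare. The constants 12 and 4
  leave enough room to absorb all error terms, so that \<open>\<epsilon> = 0\<close> works.\<close>

section \<open>Charging chunks to windows\<close>

text \<open>Where a chunk starts depends on all bits before it, across blocks that share source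
  symbols, so the law of a single chunk is hard to describe. Every charge is therefore bounded by a
  function of \<open>n + 1\<close> consecutive bits of one block, whatever chunk is open there;
  expectations then add up despite the dependence between blocks. Only the charge for short chunks
  outside the exempt set \<open>S\<close> looks at the source symbols, because \<open>S\<close> is
  built from them; it is bounded conditionally on the symbols, the other charges through the
  marginal law of a block.

  The length \<open>n\<close> serves two purposes. Up to powers of \<open>n\<close>, about
  \<open>A * L * 2 powr (n * h)\<close> strings lie near a source window, where
  \<open>h = H(\<gamma>, \<gamma>)\<close>; as \<open>h < H\<close>, this is below
  \<open>B * L\<close> by a power of \<open>B / A\<close>. And \<open>n / 2 ^ (M + 1)\<close> is
  about \<open>c\<^sub>M\<close>, the exponent for a window without marker.

  The pointers use about half of the second term of the bound. As
  \<open>2 ^ M = O(log (B / A))\<close> keeps \<open>c\<^sub>M\<close> above a positive constant,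
  the other half stays away from zero and pays for all vanishing terms.\<close>

abbreviation marker :: "nat \<Rightarrow> bool list" where
  "marker M \<equiv> replicate M False"

section \<open>Bit count of the encoder\<close>

lemma length_pointer_le:
  assumes "length D \<le> N" "D \<noteq> []"
  shows "real (length (pointer D z)) \<le> log 2 (real N) + 1"
proof -
  have D: "real (length D) \<ge> 1"
    using assms(2) by (cases D) auto
  have "log 2 (real (length D)) \<ge> log 2 1"
    using D by (intro log_mono) auto
  then have "real (length (pointer D z)) \<le> log 2 (real (length D)) + 1"
    by (simp add: pointer_def binary_def)
  moreover have "log 2 (real (length D)) \<le> log 2 (real N)"
    using assms D by (intro log_mono) auto
  ultimately show ?thesis
    by linarith
qed

text \<open>A literal copy of a string is sent at most once, so the strings of \<open>S\<close> cost
  at most their total length over the whole run; the last sum is what may still be due when the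
  dictionary is \<open>D\<close>. Each step moves at most one item from \<open>zs\<close> to
  \<open>D\<close>, so \<open>N\<close> bounds every later dictionary.\<close>

lemma length_encode_chunks_le:
  assumes "finite S" "length D + length zs \<le> N"
  shows "real (length (encode_chunks D zs)) \<le>
    (\<Sum>z\<leftarrow>zs. 2 + log 2 (real N) + (if z \<in> S then 0 else real (length z))) +
    (\<Sum>z\<in>S - set D. real (length z))"
  using assms(2)
proof (induction zs arbitrary: D)
  case Nil
  then show ?case by (simp add: sum_nonneg)
next
  case (Cons z zs)
  have N: "log 2 (real N) \<ge> 0"
    using Cons.prems by (simp add: zero_le_log_cancel_iff)
  show ?case
  proof (cases "z \<in> set D")
    case True
    then have "real (length (pointer D z)) \<le> log 2 (real N) + 1"
      using Cons.prems by (intro length_pointer_le) auto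
    then show ?thesis
      using Cons.IH[of D] Cons.prems True by auto
  next
    case False
    have IH: "real (length (encode_chunks (D @ [z]) zs)) \<le>
      (\<Sum>z\<leftarrow>zs. 2 + log 2 (real N) + (if z \<in> S then 0 else real (length z))) +
      (\<Sum>y\<in>S - insert z (set D). real (length y))"
      using Cons.IH[of "D @ [z]"] Cons.prems by simp
    show ?thesis
    proof (cases "z \<in> S")
      case True
      have "(\<Sum>y\<in>S - set D. real (length y)) =
          real (length z) + (\<Sum>y\<in>(S - set D) - {z}. real (length y))"
        using True False assms(1) by (intro sum.remove) auto
      moreover have "(S - set D) - {z} = S - insert z (set D)"
        by auto
      ultimately show ?thesis
        using IH False True N by simp
    next
      case z: False
      then have "S - insert z (set D) = S - set D"
        by auto
      then show ?thesis
        using IH False z N by simp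
    qed
  qed
qed

lemma length_chunks_from_le: "length (chunks_from M acc s) \<le> length acc + length s"
proof (induction s arbitrary: acc)
  case Nil
  then show ?case by (cases acc) auto
next
  case (Cons x s)
  show ?case
    using Cons.IH[of "[]"] Cons.IH[of "acc @ [x]"] by auto
qed

lemma length_elias_gamma_le:
  assumes "n \<le> N" "N \<ge> 1"
  shows "real (length (elias_gamma n)) \<le> 2 * log 2 (real N) + 1"
proof -
  have N: "log 2 (real N) \<ge> 0"
    using assms by (simp add: zero_le_log_cancel_iff)
  have "real (nat \<lfloor>log 2 (real n)\<rfloor>) \<le> log 2 (real N)"
  proof (cases "n = 0")
    case True
    \<comment> \<open>By convention \<open>ln 0 = 0\<close>, so the code of 0 is a single
      bit.\<close>
    then show ?thesis using N by (simp add: log_def)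
  next
    case False
    then have "log 2 (real n) \<ge> 0" "log 2 (real n) \<le> log 2 (real N)"
      using assms by (simp_all add: zero_le_log_cancel_iff)
    then show ?thesis
      by linarith
  qed
  then show ?thesis
    by (simp add: elias_gamma_def Let_def binary_def)
qed

text \<open>An upper bound for the cost of a chunk \<open>z\<close>: a flag with a pointer (at most \<open>\<kappa>\<close> bits) and, if
  \<open>z \<notin> S\<close>, its literal copy, whose bits beyond the first \<open>n\<close> are counted separately.\<close>

definition chunk_cost :: "real \<Rightarrow> nat \<Rightarrow> bool list set \<Rightarrow> bool list \<Rightarrow> real" where
  "chunk_cost \<kappa> n S z = \<kappa> + real (length z - n) + real n * of_bool (z \<notin> S)"

text \<open>The cost charged to the last bit of a window of \<open>n + 1\<close> bits: this bit may lie beyond the first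
  \<open>n\<close> bits of its chunk, it may end a chunk longer than \<open>n\<close> or a short chunk outside \<open>S\<close>, and it may
  end some chunk.\<close>

definition window_cost :: "real \<Rightarrow> nat \<Rightarrow> nat \<Rightarrow> bool list set \<Rightarrow> bool list \<Rightarrow> real" where
  "window_cost \<kappa> n M S w =
     of_bool (\<not> sublist (marker M) (butlast w)) +
     real n * of_bool (\<not> sublist (marker M) (butlast w) \<and> suffix (marker M) w) +
     real n * of_bool (\<exists>z. suffix z w \<and> length z \<le> n \<and> z \<notin> S) +
     \<kappa> * of_bool (suffix (marker M) w)"

text \<open>Here \<open>h\<close> is the part of the current block read so far, ending in the
  charged bit. The first \<open>n\<close> bits of a block have no full window inside it and get a
  flat charge that covers every case, so that no window straddles two blocks.\<close>

definition bit_cost :: "real \<Rightarrow> nat \<Rightarrow> nat \<Rightarrow> bool list set \<Rightarrow> bool list \<Rightarrow> real" where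
  "bit_cost \<kappa> n M S h =
     (if length h \<le> n then \<kappa> + real n + 1
      else window_cost \<kappa> n M S (drop (length h - Suc n) h))"

text \<open>Bits of the open chunk \<open>acc\<close> beyond the first \<open>n\<close> have already been charged when they were read,
  hence the subtraction.\<close>

definition open_cost :: "real \<Rightarrow> nat \<Rightarrow> nat \<Rightarrow> bool list set \<Rightarrow> bool list \<Rightarrow> bool list \<Rightarrow> real" where
  "open_cost \<kappa> n M S acc s =
     (\<Sum>z\<leftarrow>chunks_from M acc s. chunk_cost \<kappa> n S z) - real (length acc - n)"

lemma window_cost_nonneg: "\<kappa> \<ge> 0 \<Longrightarrow> window_cost \<kappa> n M S w \<ge> 0"
  by (simp add: window_cost_def)

text \<open>The open chunk and the part \<open>h\<close> of the block are suffixes of one stream, so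
  one is a suffix of the other. Suppose \<open>h\<close> has at least \<open>n\<close> bits. If
  \<open>acc\<close> has so too, it contains the \<open>n\<close> bits before \<open>x\<close>,
  which are then marker-free, and the first two window terms pay for the excess bit and for a long
  chunk that closes. Otherwise a closing chunk \<open>acc @ [x]\<close> is a suffix of the window
  with at most \<open>n\<close> bits, and the third term pays.\<close>

lemma open_cost_step:
  assumes M: "M > 0" "M \<le> Suc n" and \<kappa>: "\<kappa> \<ge> 0"
    and acc: "\<not> sublist (marker M) acc"
    and comp: "suffix acc h \<or> suffix h acc"
  shows "open_cost \<kappa> n M S acc (x # xs) \<le> bit_cost \<kappa> n M S (h @ [x]) +
    open_cost \<kappa> n M S (if suffix (marker M) (acc @ [x]) then [] else acc @ [x]) xs"
proof -
  define cl where "cl \<longleftrightarrow> suffix (marker M) (acc @ [x])"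
  define incr where "incr = real (length (acc @ [x]) - n) - real (length acc - n)"
  have incr: "incr = of_bool (length acc \<ge> n)"
    by (auto simp: incr_def)
  have eq: "open_cost \<kappa> n M S acc (x # xs) =
     incr + of_bool cl * (\<kappa> + real n * of_bool (acc @ [x] \<notin> S)) +
     open_cost \<kappa> n M S (if cl then [] else acc @ [x]) xs"
    by (auto simp: open_cost_def cl_def incr_def chunk_cost_def simp del: suffix_snoc)
  have "incr + of_bool cl * (\<kappa> + real n * of_bool (acc @ [x] \<notin> S)) \<le> bit_cost \<kappa> n M S (h @ [x])"
  proof (cases "length h < n")
    case True
    then have "bit_cost \<kappa> n M S (h @ [x]) = \<kappa> + real n + 1"
      by (simp add: bit_cost_def)
    then show ?thesis
      using \<kappa> by (auto simp: incr)
  next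
    case False
    define v where "v = drop (length h - n) h"
    have v: "length v = n" "suffix v h"
      using False by (auto simp: v_def suffix_drop)
    have bc: "bit_cost \<kappa> n M S (h @ [x]) = window_cost \<kappa> n M S (v @ [x])"
      using False by (simp add: bit_cost_def v_def)
    have cmp: "suffix acc v \<or> suffix v acc"
      using comp v(2) suffix_same_cases suffix_order.trans by blast
    have long: "suffix v acc" if "length acc \<ge> n"
      using that cmp v(1) suffix_length_suffix
      by (metis le_antisym suffix_length_le suffix_order.refl)
    have nomark: "\<not> sublist (marker M) v" if "length acc \<ge> n"
      using long[OF that] acc suffix_imp_sublist sublist_order.order_trans by blast
    have mark: "suffix (marker M) (v @ [x])" if cl
    proof -
      \<comment> \<open>Suffixes of one word are ordered by length, and the marker has at most
        \<open>n + 1\<close> bits, so it ends the window as well.\<close>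
      have "suffix (acc @ [x]) (v @ [x]) \<or> suffix (v @ [x]) (acc @ [x])"
        using cmp by auto
      then show ?thesis
        using that M(2) v(1) unfolding cl_def
        by (metis length_append_singleton length_replicate suffix_length_suffix suffix_order.trans)
    qed
    have short: "suffix (acc @ [x]) (v @ [x])" "length (acc @ [x]) \<le> n" if "\<not> length acc \<ge> n"
      using that cmp v(1) by (auto dest: suffix_length_le)
    show ?thesis
    proof (cases "length acc \<ge> n")
      case True
      then show ?thesis
        using nomark[OF True] mark \<kappa>
        unfolding bc window_cost_def incr butlast_snoc by (cases cl) auto
    next
      case f: False
      have b1: "real n * of_bool (acc @ [x] \<notin> S) \<le>
          real n * of_bool (\<exists>z. suffix z (v @ [x]) \<and> length z \<le> n \<and> z \<notin> S)"
      proof (cases "acc @ [x] \<in> S")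
        case False
        then have "\<exists>z. suffix z (v @ [x]) \<and> length z \<le> n \<and> z \<notin> S"
          using short[OF f] by blast
        then show ?thesis
          by simp
      qed simp
      have b2: "window_cost \<kappa> n M S (v @ [x]) \<ge>
          real n * of_bool (\<exists>z. suffix z (v @ [x]) \<and> length z \<le> n \<and> z \<notin> S) +
          \<kappa> * of_bool (suffix (marker M) (v @ [x]))"
        unfolding window_cost_def by simp
      have "of_bool cl * (\<kappa> + real n * of_bool (acc @ [x] \<notin> S)) \<le>
          window_cost \<kappa> n M S (v @ [x])"
      proof (cases cl)
        case True
        then have one: "of_bool cl = (1 :: real)" "of_bool (suffix (marker M) (v @ [x])) = (1 :: real)"
          using mark by simp_all
        show ?thesis
          using add_left_mono[OF b1, of \<kappa>] b2 unfolding one by (simp only: mult_1 mult_1_right add.commute)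
      qed (simp add: window_cost_nonneg[OF \<kappa>])
      then show ?thesis
        using f by (simp add: bc incr)
    qed
  qed
  then show ?thesis
    using eq by (simp add: cl_def)
qed

text \<open>The bound \<open>R\<close> is uniform in the chunk left open at the end of
  \<open>u\<close>; this is what decouples a block from its successors.\<close>

lemma open_cost_append:
  assumes M: "M > 0" "M \<le> Suc n" and \<kappa>: "\<kappa> \<ge> 0"
    and rest: "\<And>acc. \<not> sublist (marker M) acc \<Longrightarrow> open_cost \<kappa> n M S acc rest \<le> R"
    and acc: "\<not> sublist (marker M) acc"
    and comp: "suffix acc h \<or> suffix h acc"
  shows "open_cost \<kappa> n M S acc (u @ rest) \<le>
    (\<Sum>i<length u. bit_cost \<kappa> n M S (h @ take (Suc i) u)) + R"
  using acc comp
proof (induction u arbitrary: acc h)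
  case Nil
  then show ?case using rest by simp
next
  case (Cons x u)
  define acc' where "acc' = (if suffix (marker M) (acc @ [x]) then [] else acc @ [x])"
  have "open_cost \<kappa> n M S acc' (u @ rest) \<le>
      (\<Sum>i<length u. bit_cost \<kappa> n M S ((h @ [x]) @ take (Suc i) u)) + R"
  proof (rule Cons.IH)
    show "\<not> sublist (marker M) acc'"
      using Cons.prems(1) M(1)
      by (auto simp: acc'_def sublist_snoc simp del: suffix_snoc)
    show "suffix acc' (h @ [x]) \<or> suffix (h @ [x]) acc'"
      using Cons.prems(2) by (auto simp: acc'_def)
  qed
  then show ?case
    using open_cost_step[OF M \<kappa> Cons.prems, of S x "u @ rest"]
    by (simp add: acc'_def sum.lessThan_Suc_shift del: sum.lessThan_Suc)
qed

definition block_cost :: "real \<Rightarrow> nat \<Rightarrow> nat \<Rightarrow> bool list set \<Rightarrow> bool list \<Rightarrow> real" where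
  "block_cost \<kappa> n M S Y = (\<Sum>i<length Y - n. window_cost \<kappa> n M S (take (Suc n) (drop i Y)))"

lemma sum_bit_cost_le:
  assumes "\<kappa> \<ge> 0"
  shows "(\<Sum>i<length Y. bit_cost \<kappa> n M S (take (Suc i) Y)) \<le>
    real n * (\<kappa> + real n + 1) + block_cost \<kappa> n M S Y"
proof -
  define m where "m = min n (length Y)"
  have "{..<length Y} = {..<m} \<union> {m..<length Y}"
    by (auto simp: m_def)
  then have "(\<Sum>i<length Y. bit_cost \<kappa> n M S (take (Suc i) Y)) =
      (\<Sum>i<m. bit_cost \<kappa> n M S (take (Suc i) Y)) +
      (\<Sum>i=m..<length Y. bit_cost \<kappa> n M S (take (Suc i) Y))"
    by (simp add: sum.union_disjoint ivl_disj_int)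
  moreover have "(\<Sum>i<m. bit_cost \<kappa> n M S (take (Suc i) Y)) = real m * (\<kappa> + real n + 1)"
    by (simp add: bit_cost_def m_def)
  moreover have "\<dots> \<le> real n * (\<kappa> + real n + 1)"
    using assms by (intro mult_right_mono) (auto simp: m_def)
  moreover have "(\<Sum>i=m..<length Y. bit_cost \<kappa> n M S (take (Suc i) Y)) = block_cost \<kappa> n M S Y"
    unfolding block_cost_def
    by (rule sum.reindex_bij_witness[where j = "\<lambda>i. i - n" and i = "\<lambda>i. i + n"])
      (auto simp: m_def bit_cost_def drop_take split: if_splits)
  ultimately show ?thesis
    by linarith
qed

lemma open_cost_concat_le:
  assumes M: "M > 0" "M \<le> Suc n" and \<kappa>: "\<kappa> \<ge> 0"
    and acc: "\<not> sublist (marker M) acc"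
  shows "open_cost \<kappa> n M S acc (concat Ys) \<le>
    (\<Sum>Y\<leftarrow>Ys. real n * (\<kappa> + real n + 1) + block_cost \<kappa> n M S Y) + (\<kappa> + real n)"
  using acc
proof (induction Ys arbitrary: acc)
  case Nil
  \<comment> \<open>The last chunk may end without a marker. Its bits beyond the first
    \<open>n\<close> were charged when read, which leaves at most
    \<open>\<kappa> + n\<close>.\<close>
  then show ?case using \<kappa> by (auto simp: open_cost_def chunk_cost_def)
next
  case (Cons Y Ys)
  \<comment> \<open>Each block starts with the empty history, which is a suffix of any chunk
    inherited from the previous block.\<close>
  show ?case
    using open_cost_append[OF M \<kappa> Cons.IH Cons.prems, where h = "[]" and u = Y]
      sum_bit_cost_le[OF \<kappa>, of n M S Y] by simp
qed

text \<open>This is deterministic and holds for every finite \<open>S\<close>. In the random model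
  \<open>S\<close> will depend on the source symbols, but not on the indices or the flips.\<close>

lemma vld_length_le:
  assumes M: "M > 0" "M \<le> Suc n" and S: "finite S"
    and N: "length (concat Ys) \<le> N" "N \<ge> 1" and \<kappa>: "\<kappa> = 2 + log 2 (real N)"
  shows "real (vld_length M (concat Ys)) \<le>
    2 * \<kappa> + (\<Sum>z\<in>S. real (length z)) + (\<kappa> + real n) +
    real (length Ys) * (real n * (\<kappa> + real n + 1)) + (\<Sum>Y\<leftarrow>Ys. block_cost \<kappa> n M S Y)"
proof -
  define zs where "zs = vld_chunks M (concat Ys)"
  have \<kappa>0: "\<kappa> \<ge> 0"
    using N by (simp add: \<kappa> zero_le_log_cancel_iff add_nonneg_nonneg)
  \<comment> \<open>Chunks are nonempty, so there are at most as many chunks as bits.\<close>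
  have len: "length zs \<le> N"
    using N(1) length_chunks_from_le[of M "[]" "concat Ys"] by (simp add: zs_def vld_chunks_def)
  have "real (length (encode_chunks [] zs)) \<le>
      (\<Sum>z\<leftarrow>zs. \<kappa> + (if z \<in> S then 0 else real (length z))) + (\<Sum>z\<in>S. real (length z))"
    using length_encode_chunks_le[OF S, of "[]" zs N] len by (simp add: \<kappa>)
  also have "(\<Sum>z\<leftarrow>zs. \<kappa> + (if z \<in> S then 0 else real (length z))) \<le>
      (\<Sum>z\<leftarrow>zs. chunk_cost \<kappa> n S z)"
    by (intro sum_list_mono) (auto simp: chunk_cost_def)
  also have "(\<Sum>z\<leftarrow>zs. chunk_cost \<kappa> n S z) = open_cost \<kappa> n M S [] (concat Ys)"
    by (simp add: open_cost_def zs_def vld_chunks_def)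
  also have "\<dots> \<le> (\<Sum>Y\<leftarrow>Ys. real n * (\<kappa> + real n + 1) + block_cost \<kappa> n M S Y) + (\<kappa> + real n)"
    using M(1) by (intro open_cost_concat_le[OF M \<kappa>0]) auto
  finally have "real (length (encode_chunks [] zs)) \<le>
     (\<Sum>Y\<leftarrow>Ys. real n * (\<kappa> + real n + 1) + block_cost \<kappa> n M S Y) + (\<kappa> + real n) +
     (\<Sum>z\<in>S. real (length z))"
    by simp
  moreover have "real (length (elias_gamma (length (concat Ys)))) \<le> 2 * \<kappa>"
    using length_elias_gamma_le[OF N] \<kappa>0 by (simp add: \<kappa>)
  ultimately show ?thesis
    by (simp add: vld_length_def vld_encode_def zs_def sum_list_addf sum_list_triv)
qed

section \<open>Words without marker\<close>

definition no_marker :: "nat \<Rightarrow> nat \<Rightarrow> bool list set" where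
  "no_marker M n = {w. length w = n \<and> \<not> sublist (marker M) w}"

lemma finite_bool_lists: "finite {w :: bool list. length w = n}"
  using finite_lists_length_eq[of "UNIV :: bool set" n] by simp

lemma card_bool_lists: "card {w :: bool list. length w = n} = 2 ^ n"
  using card_lists_length_eq[of "UNIV :: bool set" n] by (simp add: card_UNIV_bool)

lemma finite_no_marker: "finite (no_marker M n)"
  unfolding no_marker_def by (rule finite_subset[OF _ finite_bool_lists[of n]]) auto

text \<open>An occurrence of the marker cannot contain the \<open>True\<close>, and the zeros after
  it are too few.\<close>

lemma sublist_marker_append_True:
  assumes "k < M"
  shows "sublist (marker M) (u @ True # replicate k False) \<longleftrightarrow> sublist (marker M) u"
proof
  assume "sublist (marker M) (u @ True # replicate k False)"
  then consider "sublist (marker M) u" | "sublist (marker M) (True # replicate k False)"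
    | xs1 xs2 where "marker M = xs1 @ xs2" "suffix xs1 u" "prefix xs2 (True # replicate k False)"
    unfolding sublist_append by blast
  then show "sublist (marker M) u"
  proof cases
    case 2
    then have "prefix (marker M) (True # replicate k False) \<or> sublist (marker M) (replicate k False)"
      by (simp add: sublist_Cons_right)
    then show ?thesis
      using assms by (cases M) (auto dest: sublist_length_le)
  next
    case 3
    then have "True \<notin> set xs2"
      by (metis Un_iff in_set_replicate set_append)
    with 3(3) have "xs2 = []"
      by (cases xs2) auto
    with 3 show ?thesis
      by (auto simp: suffix_imp_sublist)
  qed
qed (auto simp: sublist_append)

text \<open>The bit before the final marker must be a one, since a zero would complete a marker one
  place earlier. In front of it remain \<open>n + 1 - M - 1 = n - M\<close> bits.\<close>

lemma first_marker_at_end_eq: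
  assumes "M > 0" "M \<le> n"
  shows "{w. length w = Suc n \<and> \<not> sublist (marker M) (butlast w) \<and> suffix (marker M) w} =
    (\<lambda>u. u @ True # marker M) ` no_marker M (n - M)" (is "?L = ?R")
proof (intro equalityI subsetI)
  fix w assume w: "w \<in> ?L"
  then obtain v where v: "w = v @ marker M"
    by (auto simp: suffix_def)
  with w assms have "v \<noteq> []"
    by auto
  then obtain u b where u: "v = u @ [b]"
    by (cases v rule: rev_cases) auto
  obtain k where k: "M = Suc k"
    using assms by (cases M) auto
  have mk: "marker M = replicate k False @ [False]"
    by (simp add: k replicate_append_same)
  have b: b
  proof (rule ccontr)
    assume "\<not> b"
    then have "butlast w = u @ marker M"
      by (simp add: v u mk butlast_append) (simp add: k replicate_append_same)
    with w show False
      by auto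
  qed
  have "butlast w = u @ True # replicate k False"
    using b by (simp add: v u mk butlast_append)
  then have "\<not> sublist (marker M) u"
    using w sublist_marker_append_True[of k M u] by (simp add: k del: replicate_Suc)
  moreover have "length u = n - M"
    using w v u assms by auto
  ultimately show "w \<in> ?R"
    using v u b by (auto simp: no_marker_def)
next
  fix w assume "w \<in> ?R"
  then obtain u where u: "w = u @ True # marker M" "length u = n - M" "\<not> sublist (marker M) u"
    by (auto simp: no_marker_def)
  obtain k where k: "M = Suc k"
    using assms by (cases M) auto
  have mk: "marker M = replicate k False @ [False]"
    by (simp add: k replicate_append_same)
  have "butlast w = u @ True # replicate k False"
    by (simp add: u mk butlast_append)
  then have "\<not> sublist (marker M) (butlast w)"
    using u(3) sublist_marker_append_True[of k M u] by (simp add: k del: replicate_Suc)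
  moreover have "suffix (marker M) w"
    unfolding u suffix_def by (intro exI[of _ "u @ [True]"]) simp
  ultimately show "w \<in> ?L"
    using u assms by auto
qed

lemma card_first_marker_at_end:
  assumes "M > 0" "M \<le> n"
  shows "card {w. length w = Suc n \<and> \<not> sublist (marker M) (butlast w) \<and> suffix (marker M) w} =
    card (no_marker M (n - M))"
  unfolding first_marker_at_end_eq[OF assms] by (rule card_image) (auto simp: inj_on_def)

lemma butlast_no_marker_eq:
  "{w. length w = Suc n \<and> \<not> sublist (marker M) (butlast w)} =
   (\<lambda>(u, b). u @ [b]) ` (no_marker M n \<times> UNIV)" (is "?L = ?R")
proof (intro equalityI subsetI)
  fix w assume "w \<in> ?L"
  then show "w \<in> ?R"
    by (cases w rule: rev_cases) (auto simp: no_marker_def)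
qed (auto simp: no_marker_def)

lemma card_butlast_no_marker:
  "card {w. length w = Suc n \<and> \<not> sublist (marker M) (butlast w)} = 2 * card (no_marker M n)"
  unfolding butlast_no_marker_eq
  by (subst card_image) (auto simp: inj_on_def card_cartesian_product card_UNIV_bool)

text \<open>Append one bit to a marker-free word: the result is again marker-free or has its first
  marker at the end.\<close>

lemma card_no_marker_Suc:
  assumes "M > 0" "M \<le> n"
  shows "card (no_marker M (Suc n)) + card (no_marker M (n - M)) = 2 * card (no_marker M n)"
proof -
  let ?E = "{w. length w = Suc n \<and> \<not> sublist (marker M) (butlast w) \<and> suffix (marker M) w}"
  have split: "{w. length w = Suc n \<and> \<not> sublist (marker M) (butlast w)} = no_marker M (Suc n) \<union> ?E"
  proof (intro equalityI subsetI)
    fix w assume "w \<in> {w. length w = Suc n \<and> \<not> sublist (marker M) (butlast w)}"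
    then show "w \<in> no_marker M (Suc n) \<union> ?E"
      by (cases w rule: rev_cases) (auto simp: no_marker_def sublist_snoc simp del: suffix_snoc)
  next
    fix w assume "w \<in> no_marker M (Suc n) \<union> ?E"
    then show "w \<in> {w. length w = Suc n \<and> \<not> sublist (marker M) (butlast w)}"
      by (auto simp: no_marker_def dest: sublist_order.order_trans[OF _ sublist_butlast])
  qed
  have disj: "no_marker M (Suc n) \<inter> ?E = {}"
    by (auto simp: no_marker_def)
  have fin: "finite ?E"
    by (rule finite_subset[OF _ finite_bool_lists[of "Suc n"]]) auto
  show ?thesis
    using card_Un_disjoint[OF finite_no_marker fin disj] card_first_marker_at_end[OF assms]
      card_butlast_no_marker[of n M] split by simp
qed

lemma card_no_marker_Suc_le: "card (no_marker M (Suc n)) \<le> 2 * card (no_marker M n)"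
proof -
  have "no_marker M (Suc n) \<subseteq> {w. length w = Suc n \<and> \<not> sublist (marker M) (butlast w)}"
    by (auto simp: no_marker_def dest: sublist_order.order_trans[OF _ sublist_butlast])
  moreover have "finite {w. length w = Suc n \<and> \<not> sublist (marker M) (butlast w)}"
    by (rule finite_subset[OF _ finite_bool_lists[of "Suc n"]]) auto
  ultimately show ?thesis
    using card_mono[of "{w. length w = Suc n \<and> \<not> sublist (marker M) (butlast w)}"
      "no_marker M (Suc n)"]
    unfolding card_butlast_no_marker by blast
qed

lemma card_no_marker_le_power: "card (no_marker M (n + k)) \<le> 2 ^ k * card (no_marker M n)"
proof (induction k)
  case (Suc k)
  then show ?case
    using card_no_marker_Suc_le[of M "n + k"] by simp
qed simp

definition no_marker_prob :: "nat \<Rightarrow> nat \<Rightarrow> real" where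
  "no_marker_prob M n = real (card (no_marker M n)) / 2 ^ n"

lemma no_marker_prob_le_1: "no_marker_prob M n \<le> 1"
proof -
  have "card (no_marker M n) \<le> 2 ^ n"
    unfolding card_bool_lists[symmetric]
    by (rule card_mono[OF finite_bool_lists]) (auto simp: no_marker_def)
  then have "real (card (no_marker M n)) \<le> 2 ^ n"
    by (metis of_nat_le_iff of_nat_numeral of_nat_power)
  then show ?thesis
    by (simp add: no_marker_prob_def)
qed

text \<open>Dropping \<open>M\<close> bits divides the number of marker-free words by at most
  \<open>2 ^ M\<close>. The term subtracted in the recurrence is thus at least a fraction
  \<open>1 / 2 ^ M\<close> of the current count, hence \<open>1 / 2 ^ (M + 1)\<close> after
  normalization.\<close>

lemma no_marker_prob_Suc_le:
  assumes "M > 0" "M \<le> n"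
  shows "no_marker_prob M (Suc n) \<le> (1 - 1 / 2 ^ (M + 1)) * no_marker_prob M n"
proof -
  have "real (card (no_marker M n)) \<le> 2 ^ M * real (card (no_marker M (n - M)))"
    using card_no_marker_le_power[of M "n - M" M] assms
    by (metis le_add_diff_inverse2 of_nat_le_iff of_nat_mult of_nat_numeral of_nat_power)
  moreover have "real (card (no_marker M (Suc n))) =
      2 * real (card (no_marker M n)) - real (card (no_marker M (n - M)))"
    using arg_cong[OF card_no_marker_Suc[OF assms], of real] by simp
  ultimately show ?thesis
    by (simp add: no_marker_prob_def) (simp add: field_simps)
qed

lemma no_marker_prob_le_exp:
  assumes "M > 0"
  shows "no_marker_prob M n \<le> exp (- (real n - real M) / 2 ^ (M + 1))"
proof (cases "n \<le> M")
  case True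
  \<comment> \<open>The exponent is nonnegative here, so the bound is trivial. The recurrence starts
    at length \<open>M\<close>, whence the shift by \<open>M\<close>.\<close>
  then have "1 \<le> exp (- (real n - real M) / 2 ^ (M + 1))"
    by simp
  then show ?thesis
    using no_marker_prob_le_1[of M n] by linarith
next
  case False
  have "no_marker_prob M (M + k) \<le> exp (- real k / 2 ^ (M + 1))" for k
  proof (induction k)
    case 0
    then show ?case by (simp add: no_marker_prob_le_1)
  next
    case (Suc k)
    have "1 - 1 / 2 ^ (M + 1) \<le> exp (- 1 / 2 ^ (M + 1) :: real)"
      using exp_ge_add_one_self[of "- 1 / 2 ^ (M + 1)"] by simp
    moreover have "(1 :: real) - 1 / 2 ^ (M + 1) \<ge> 0"
      using one_le_power[of "2 :: real" "M + 1"] by (simp add: divide_simps)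
    ultimately have "(1 - 1 / 2 ^ (M + 1)) * no_marker_prob M (M + k) \<le>
        exp (- 1 / 2 ^ (M + 1)) * exp (- real k / 2 ^ (M + 1))"
      using Suc by (intro mult_mono) (auto simp: no_marker_prob_def)
    also have "\<dots> = exp (- real (Suc k) / 2 ^ (M + 1))"
      by (simp add: exp_add[symmetric] diff_divide_distrib)
    finally show ?case
      using no_marker_prob_Suc_le[OF assms, of "M + k"] by simp
  qed
  from this[of "n - M"] False show ?thesis
    by (simp add: of_nat_diff)
qed

section \<open>Hamming balls and cross entropy\<close>

definition num_flips :: "bool list \<Rightarrow> nat" where
  "num_flips f = length (filter id f)"

definition few_flips :: "real \<Rightarrow> nat \<Rightarrow> bool list set" where
  "few_flips \<gamma> l = {f. length f = l \<and> real (num_flips f) \<le> \<gamma> * real l}"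

text \<open>In exponential form, comparing probabilities amounts to an inequality that is linear in
  the number of flips.\<close>

lemma pmf_replicate_bernoulli:
  assumes "0 < p" "p < 1"
  shows "pmf (replicate_pmf (length f) (bernoulli_pmf p)) f =
    exp (real (num_flips f) * ln p + (real (length f) - real (num_flips f)) * ln (1 - p))"
proof (induction f)
  case Nil
  then show ?case by (simp add: num_flips_def)
next
  case (Cons b f)
  have "replicate_pmf (Suc n) q = map_pmf (\<lambda>(x, xs). x # xs) (pair_pmf q (replicate_pmf n q))"
    for n and q :: "bool pmf"
    by (simp add: map_pmf_def pair_pmf_def bind_assoc_pmf bind_return_pmf)
  moreover have "inj (\<lambda>(x :: bool, xs). x # xs)"
    by (auto simp: inj_on_def)
  ultimately have "pmf (replicate_pmf (length (b # f)) (bernoulli_pmf p)) (b # f) =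
     pmf (bernoulli_pmf p) b * pmf (replicate_pmf (length f) (bernoulli_pmf p)) f"
    using pmf_map_inj'[of "\<lambda>(x :: bool, xs). x # xs"
        "pair_pmf (bernoulli_pmf p) (replicate_pmf (length f) (bernoulli_pmf p))" "(b, f)"]
    by (simp add: pmf_pair)
  also have "pmf (bernoulli_pmf p) b = exp (if b then ln p else ln (1 - p))"
    using assms by (cases b) auto
  finally show ?case
    unfolding Cons.IH exp_add[symmetric] by (auto simp: num_flips_def algebra_simps)
qed

lemma cross_entropy_ln:
  assumes "0 < q" "q < 1"
  shows "cross_entropy p q * ln 2 = - (p * ln q + (1 - p) * ln (1 - q))"
  using assms by (simp add: cross_entropy_def log_def ln_div field_simps)

text \<open>Gibbs' inequality, from \<open>ln t \<le> t - 1\<close> with strictness at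
  \<open>t = q / p\<close>. The strict gap is used twice: it keeps the noisy windows few and makes
  many flips exponentially rare.\<close>

lemma cross_entropy_self_less:
  assumes "0 < p" "p < 1" "0 < q" "q < 1" "p \<noteq> q"
  shows "cross_entropy p p < cross_entropy p q"
proof -
  have 1: "ln (q / p) < q / p - 1"
    using assms ln_le_minus_one[of "q / p"] ln_eq_minus_one[of "q / p"]
    by (metis divide_pos_pos divide_eq_1_iff order_le_less less_numeral_extra(3))
  have 2: "ln ((1 - q) / (1 - p)) \<le> (1 - q) / (1 - p) - 1"
    using assms by (intro ln_le_minus_one) auto
  have "p * ln (q / p) + (1 - p) * ln ((1 - q) / (1 - p)) <
      p * (q / p - 1) + (1 - p) * ((1 - q) / (1 - p) - 1)"
    using assms 1 2 by (intro add_less_le_mono mult_strict_left_mono mult_left_mono) auto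
  also have "\<dots> = 0"
    using assms by (simp add: field_simps)
  finally have "cross_entropy p p * ln 2 < cross_entropy p q * ln 2"
    using assms by (simp add: cross_entropy_ln ln_div algebra_simps)
  then show ?thesis
    by simp
qed

lemma cross_entropy_nonneg:
  assumes "0 \<le> p" "p \<le> 1" "0 < q" "q < 1"
  shows "cross_entropy p q \<ge> 0"
  unfolding cross_entropy_def using assms
  by (intro add_nonneg_nonneg mult_nonneg_nonneg) (auto simp: zero_le_log_cancel_iff)

lemma finite_few_flips: "finite (few_flips \<gamma> l)"
  using finite_lists_length_eq[of "UNIV :: bool set" l]
  by (rule finite_subset[rotated]) (auto simp: few_flips_def)

text \<open>Each element of the Hamming ball has probability at least \<open>2 powr (- l * H(\<gamma>, \<gamma>))\<close> under
  \<open>\<gamma>\<close>-biased flips.\<close>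

lemma card_few_flips_le:
  assumes "0 < \<gamma>" "\<gamma> < 1 / 2"
  shows "real (card (few_flips \<gamma> l)) \<le> 2 powr (real l * cross_entropy \<gamma> \<gamma>)"
proof -
  define h where "h = cross_entropy \<gamma> \<gamma>"
  let ?p = "replicate_pmf l (bernoulli_pmf \<gamma>)"
  have "2 powr (- (real l * h)) \<le> pmf ?p f" if "f \<in> few_flips \<gamma> l" for f
  proof -
    define k where "k = real (num_flips f)"
    from that have l: "length f = l" and k: "k \<le> \<gamma> * real l"
      by (auto simp: few_flips_def k_def)
    \<comment> \<open>As \<open>\<gamma> < 1 / 2\<close>, flips are less likely than non-flips, so
      the probability decreases in \<open>k\<close> and is smallest on the boundary
      \<open>k = \<gamma> * l\<close>.\<close>
    have "(\<gamma> * real l - k) * (ln (1 - \<gamma>) - ln \<gamma>) \<ge> 0"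
      using k assms by (intro mult_nonneg_nonneg) auto
    moreover have "h * ln 2 = - (\<gamma> * ln \<gamma> + (1 - \<gamma>) * ln (1 - \<gamma>))"
      using assms by (simp add: h_def cross_entropy_ln)
    then have "real l * (h * ln 2) = real l * - (\<gamma> * ln \<gamma> + (1 - \<gamma>) * ln (1 - \<gamma>))"
      by simp
    ultimately have "- (real l * h) * ln 2 \<le> k * ln \<gamma> + (real l - k) * ln (1 - \<gamma>)"
      by (simp add: algebra_simps)
    then show ?thesis
      using pmf_replicate_bernoulli[of \<gamma> f] assms l by (simp add: powr_def k_def)
  qed
  then have "real (card (few_flips \<gamma> l)) * 2 powr (- (real l * h)) \<le> (\<Sum>f\<in>few_flips \<gamma> l. pmf ?p f)"
    using sum_bounded_below[of "few_flips \<gamma> l" "2 powr (- (real l * h))" "pmf ?p"] by simp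
  also have "\<dots> = measure_pmf.prob ?p (few_flips \<gamma> l)"
    by (simp add: measure_measure_pmf_finite finite_few_flips)
  also have "\<dots> \<le> 1"
    by simp
  finally show ?thesis
    by (simp add: powr_minus divide_simps h_def mult.commute split: if_splits)
qed

text \<open>Change of measure from \<open>\<delta>\<close>-biased to \<open>\<gamma>\<close>-biased flips.\<close>

lemma prob_many_flips_le:
  assumes "0 < \<delta>" "\<delta> < \<gamma>" "\<gamma> < 1"
  shows "measure_pmf.prob (replicate_pmf l (bernoulli_pmf \<delta>)) (- few_flips \<gamma> l) \<le>
    2 powr (- (real l * (cross_entropy \<gamma> \<delta> - cross_entropy \<gamma> \<gamma>)))"
proof -
  define D where "D = cross_entropy \<gamma> \<delta> - cross_entropy \<gamma> \<gamma>"
  define F where "F = {f. length f = l} - few_flips \<gamma> l"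
  have fin: "finite F"
    unfolding F_def using finite_lists_length_eq[of "UNIV :: bool set" l] by simp
  let ?p = "replicate_pmf l (bernoulli_pmf \<delta>)"
  let ?q = "replicate_pmf l (bernoulli_pmf \<gamma>)"
  have D: "D * ln 2 = \<gamma> * (ln \<gamma> - ln \<delta>) + (1 - \<gamma>) * (ln (1 - \<gamma>) - ln (1 - \<delta>))"
    using assms by (simp add: D_def cross_entropy_ln left_diff_distrib) (simp add: algebra_simps)
  have ratio: "pmf ?p f \<le> 2 powr (- (real l * D)) * pmf ?q f" if "f \<in> F" for f
  proof -
    define k where "k = real (num_flips f)"
    from that have l: "length f = l" and k: "k > \<gamma> * real l"
      by (auto simp: F_def few_flips_def k_def)
    have "ln \<delta> < ln \<gamma>" "ln (1 - \<gamma>) < ln (1 - \<delta>)"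
      using assms by auto
    \<comment> \<open>The likelihood ratio of \<open>\<gamma>\<close> over \<open>\<delta>\<close>
      increases with the number of flips, so outside the ball it is at least its value at
      \<open>k = \<gamma> * l\<close>.\<close>
    then have "(k - \<gamma> * real l) * ((ln \<gamma> - ln \<delta>) - (ln (1 - \<gamma>) - ln (1 - \<delta>))) \<ge> 0"
      using k by (intro mult_nonneg_nonneg) auto
    moreover have "real l * D * ln 2 =
        real l * (\<gamma> * (ln \<gamma> - ln \<delta>) + (1 - \<gamma>) * (ln (1 - \<gamma>) - ln (1 - \<delta>)))"
      using D by simp
    ultimately have "k * ln \<delta> + (real l - k) * ln (1 - \<delta>) \<le>
        - (real l * D) * ln 2 + (k * ln \<gamma> + (real l - k) * ln (1 - \<gamma>))"
      by (simp add: algebra_simps)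
    then show ?thesis
      using pmf_replicate_bernoulli[of \<gamma> f] pmf_replicate_bernoulli[of \<delta> f] assms l
      by (simp add: powr_def k_def exp_add[symmetric])
  qed
  have "measure_pmf.prob ?p (- few_flips \<gamma> l) = measure_pmf.prob ?p F"
    by (rule measure_prob_cong_0) (auto simp: F_def set_replicate_pmf set_pmf_iff[symmetric] pmf_eq_0_set_pmf)
  also have "\<dots> = (\<Sum>f\<in>F. pmf ?p f)"
    by (simp add: measure_measure_pmf_finite fin)
  also have "\<dots> \<le> (\<Sum>f\<in>F. 2 powr (- (real l * D)) * pmf ?q f)"
    by (intro sum_mono ratio)
  also have "\<dots> = 2 powr (- (real l * D)) * measure_pmf.prob ?q F"
    by (simp add: measure_measure_pmf_finite fin sum_distrib_left)
  also have "\<dots> \<le> 2 powr (- (real l * D)) * 1"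
    by (intro mult_left_mono) auto
  finally show ?thesis
    by (simp add: D_def)
qed

section \<open>Expectations over the source model\<close>

abbreviation expect :: "'a pmf \<Rightarrow> ('a \<Rightarrow> real) \<Rightarrow> real" where
  "expect \<equiv> measure_pmf.expectation"

section \<open>Expectations over finitely supported distributions\<close>

lemma expect_bind_pmf:
  assumes "finite (set_pmf p)" "\<And>x. x \<in> set_pmf p \<Longrightarrow> finite (set_pmf (f x))"
  shows "expect (bind_pmf p f) h = expect p (\<lambda>x. expect (f x) h)"
  using assms by (simp add: pmf_expectation_bind[of "set_pmf p"] integral_measure_pmf[of "set_pmf p"])

lemma expect_mono:
  assumes "finite (set_pmf p)" "\<And>x. x \<in> set_pmf p \<Longrightarrow> f x \<le> g x"
  shows "expect p f \<le> expect p g"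
  using assms by (intro integral_mono_AE integrable_measure_pmf_finite) (auto simp: AE_measure_pmf_iff)

lemma expect_cong:
  assumes "\<And>x. x \<in> set_pmf p \<Longrightarrow> f x = g x"
  shows "expect p f = expect p g"
  using assms by (intro integral_cong_AE) (auto simp: AE_measure_pmf_iff)

lemma expect_le_const:
  assumes "finite (set_pmf p)" "\<And>x. x \<in> set_pmf p \<Longrightarrow> f x \<le> C"
  shows "expect p f \<le> C"
  using expect_mono[OF assms(1), of f "\<lambda>_. C"] assms(2) by simp

lemma expect_add:
  "finite (set_pmf p) \<Longrightarrow> expect p (\<lambda>x. f x + g x) = expect p f + expect p g"
  by (intro Bochner_Integration.integral_add integrable_measure_pmf_finite)

lemma expect_sum:
  "finite (set_pmf p) \<Longrightarrow> expect p (\<lambda>x. \<Sum>i\<in>I. f i x) = (\<Sum>i\<in>I. expect p (f i))"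
  by (intro Bochner_Integration.integral_sum integrable_measure_pmf_finite)

lemma expect_of_bool: "expect p (\<lambda>x. of_bool (Q x)) = measure_pmf.prob p {x. Q x}"
proof -
  have "(\<lambda>x. of_bool (Q x)) = indicat_real {x. Q x}"
    by (auto simp: indicator_def)
  then show ?thesis
    by simp
qed

lemma finite_set_replicate_pmf:
  "finite (set_pmf p) \<Longrightarrow> finite (set_pmf (replicate_pmf n p))"
  unfolding set_replicate_pmf using finite_lists_length_eq[of "set_pmf p" n]
  by (simp add: lists_eq_set)

lemma expect_sum_list_replicate_pmf:
  assumes "finite (set_pmf p)"
  shows "expect (replicate_pmf n p) (\<lambda>xs. \<Sum>x\<leftarrow>xs. f x) = real n * expect p f"
proof (induction n)
  case (Suc n)
  have fin: "finite (set_pmf (replicate_pmf n p))"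
    by (rule finite_set_replicate_pmf[OF assms])
  have "expect (replicate_pmf (Suc n) p) (\<lambda>xs. \<Sum>x\<leftarrow>xs. f x) =
      expect p (\<lambda>x. expect (replicate_pmf n p) (\<lambda>xs. f x + (\<Sum>x\<leftarrow>xs. f x)))"
    using assms fin by (simp add: expect_bind_pmf)
  also have "\<dots> = expect p (\<lambda>x. f x + real n * expect p f)"
    using fin Suc by (simp add: expect_add)
  also have "\<dots> = real (Suc n) * expect p f"
    using assms by (simp add: expect_add algebra_simps)
  finally show ?case .
qed simp

lemma map_nth_replicate_pmf: "j < n \<Longrightarrow> map_pmf (\<lambda>xs. xs ! j) (replicate_pmf n p) = p"
proof (induction n arbitrary: j)
  case (Suc n)
  show ?case
  proof (cases j)
    case 0
    then show ?thesis
      by (simp add: map_bind_pmf bind_return_pmf')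
  next
    case (Suc i)
    then have "map_pmf (\<lambda>xs. xs ! j) (replicate_pmf (Suc n) p) =
        bind_pmf p (\<lambda>_. map_pmf (\<lambda>xs. xs ! i) (replicate_pmf n p))"
      by (simp add: map_bind_pmf) (simp add: map_pmf_def)
    then show ?thesis
      using Suc.IH[of i] Suc.prems Suc by simp
  qed
qed simp

lemma map_window_replicate_pmf:
  assumes "i + m \<le> n"
  shows "map_pmf (\<lambda>xs. take m (drop i xs)) (replicate_pmf n p) = replicate_pmf m p"
proof -
  obtain k where n: "n = i + (m + k)"
    using assms by (metis add.assoc le_iff_add)
  have "map_pmf (\<lambda>xs. take m (drop i xs)) (replicate_pmf n p) =
     bind_pmf (replicate_pmf i p) (\<lambda>xs. bind_pmf (replicate_pmf m p) (\<lambda>ys.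
       bind_pmf (replicate_pmf k p) (\<lambda>zs. return_pmf (take m (drop i (xs @ ys @ zs))))))"
    unfolding n replicate_pmf_distrib by (simp add: map_bind_pmf bind_assoc_pmf bind_return_pmf)
  also have "\<dots> = bind_pmf (replicate_pmf i p) (\<lambda>xs. bind_pmf (replicate_pmf m p) (\<lambda>ys.
       bind_pmf (replicate_pmf k p) (\<lambda>zs. return_pmf ys)))"
    by (intro bind_pmf_cong refl) (auto simp: set_replicate_pmf)
  also have "\<dots> = replicate_pmf m p"
    by (simp add: bind_return_pmf')
  finally show ?thesis .
qed

section \<open>Law of one block and of its windows\<close>

lemma uniform_bits_eq_replicate_pmf: "uniform_bits n = replicate_pmf n (bernoulli_pmf (1 / 2))"
proof (rule pmf_eqI)
  fix xs :: "bool list"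
  have ne: "{xs :: bool list. length xs = n} \<noteq> {}"
    by (auto intro: exI[of _ "replicate n True"])
  show "pmf (uniform_bits n) xs = pmf (replicate_pmf n (bernoulli_pmf (1 / 2))) xs"
  proof (cases "length xs = n")
    case True
    have "pmf (replicate_pmf n (bernoulli_pmf (1 / 2))) xs = exp (real n * ln (1 / 2))"
      using pmf_replicate_bernoulli[of "1 / 2" xs] True by (simp add: algebra_simps)
    also have "\<dots> = 1 / 2 ^ n"
      by (simp add: exp_of_nat_mult power_divide)
    finally show ?thesis
      using True by (simp add: uniform_bits_def pmf_of_set[OF ne finite_bool_lists] card_bool_lists)
  next
    case False
    then have "xs \<notin> set_pmf (replicate_pmf n (bernoulli_pmf (1 / 2)))"
      by (auto simp: set_replicate_pmf)
    then show ?thesis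
      using False by (simp add: uniform_bits_def pmf_of_set[OF ne finite_bool_lists] set_pmf_iff)
  qed
qed

lemma set_uniform_bits: "set_pmf (uniform_bits n) = {xs. length xs = n}"
  unfolding uniform_bits_def
  by (rule set_pmf_of_set) (auto simp: finite_bool_lists intro: exI[of _ "replicate n True"])

lemma expect_uniform_bits_of_bool:
  "expect (uniform_bits n) (\<lambda>w. of_bool (Q w)) = real (card {w. length w = n \<and> Q w}) / 2 ^ n"
proof -
  have ne: "{xs :: bool list. length xs = n} \<noteq> {}"
    by (auto intro: exI[of _ "replicate n True"])
  have "{xs. length xs = n} \<inter> {w. Q w} = {w. length w = n \<and> Q w}"
    by auto
  then show ?thesis
    unfolding expect_of_bool uniform_bits_def
    by (simp add: measure_pmf_of_set[OF ne finite_bool_lists] card_bool_lists)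
qed

lemma bij_betw_map2_neq:
  assumes "length f = n"
  shows "bij_betw (\<lambda>xs. map2 (\<noteq>) xs f) {xs :: bool list. length xs = n} {xs. length xs = n}"
proof -
  have inv: "map2 (\<noteq>) (map2 (\<noteq>) xs f) f = xs" if "length xs = n" for xs
    using assms that by (intro nth_equalityI) auto
  show ?thesis
    by (rule bij_betwI[where g = "\<lambda>xs. map2 (\<noteq>) xs f"]) (use assms inv in auto)
qed

lemma finite_set_edit: "finite (set_pmf (edit \<delta> xs))"
  unfolding edit_def by (simp add: finite_set_replicate_pmf)

text \<open>For fixed flips an edit is a bitwise exclusive or, a bijection on words of length
  \<open>n\<close>. Drawing the flips first therefore leaves the uniform law in place.\<close>

lemma bind_uniform_bits_edit: "bind_pmf (uniform_bits n) (edit \<delta>) = uniform_bits n"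
proof -
  let ?r = "replicate_pmf n (bernoulli_pmf \<delta>)"
  have ne: "{xs :: bool list. length xs = n} \<noteq> {}"
    by (auto intro: exI[of _ "replicate n True"])
  have "bind_pmf (uniform_bits n) (edit \<delta>) =
      bind_pmf (uniform_bits n) (\<lambda>xs. bind_pmf ?r (\<lambda>f. return_pmf (map2 (\<noteq>) xs f)))"
    by (intro bind_pmf_cong refl) (auto simp: set_uniform_bits edit_def map_pmf_def)
  also have "\<dots> = bind_pmf ?r (\<lambda>f. map_pmf (\<lambda>xs. map2 (\<noteq>) xs f) (uniform_bits n))"
    unfolding map_pmf_def by (rule bind_commute_pmf)
  also have "\<dots> = bind_pmf ?r (\<lambda>f. uniform_bits n)"
    unfolding uniform_bits_def
    by (intro bind_pmf_cong refl map_pmf_of_set_bij_betw[OF bij_betw_map2_neq ne finite_bool_lists])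
      (auto simp: set_replicate_pmf)
  finally show ?thesis
    by simp
qed

lemma bind_source_symbol_edit: "bind_pmf (source_symbol P) (edit \<delta>) = source_symbol P"
  by (simp add: source_symbol_def bind_assoc_pmf bind_uniform_bits_edit)

text \<open>Draw the index first: the selected symbol has law \<open>source_symbol P\<close>, which
  edits preserve. Blocks are dependent through \<open>Xs\<close>, but the expectation of a sum of
  costs per block sees only this marginal.\<close>

lemma bind_source_block:
  assumes "A > 0"
  shows "bind_pmf (replicate_pmf A (source_symbol P)) (source_block \<delta>) = source_symbol P"
proof -
  let ?Q = "source_symbol P"
  have "bind_pmf (replicate_pmf A ?Q) (source_block \<delta>) =
      bind_pmf (replicate_pmf A ?Q) (\<lambda>Xs. bind_pmf (pmf_of_set {..<A}) (\<lambda>j. edit \<delta> (Xs ! j)))"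
    by (intro bind_pmf_cong refl) (auto simp: set_replicate_pmf source_block_def)
  also have "\<dots> = bind_pmf (pmf_of_set {..<A}) (\<lambda>j. bind_pmf (replicate_pmf A ?Q) (\<lambda>Xs. edit \<delta> (Xs ! j)))"
    by (rule bind_commute_pmf)
  also have "\<dots> = bind_pmf (pmf_of_set {..<A})
      (\<lambda>j. bind_pmf (map_pmf (\<lambda>Xs. Xs ! j) (replicate_pmf A ?Q)) (edit \<delta>))"
    by (simp add: bind_map_pmf)
  also have "\<dots> = bind_pmf (pmf_of_set {..<A}) (\<lambda>j. bind_pmf ?Q (edit \<delta>))"
    using assms by (intro bind_pmf_cong refl) (auto simp: map_nth_replicate_pmf lessThan_empty_iff)
  also have "\<dots> = ?Q"
    by (simp add: bind_source_symbol_edit)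
  finally show ?thesis .
qed

lemma finite_set_source_symbol: "finite (set_pmf P) \<Longrightarrow> finite (set_pmf (source_symbol P))"
  by (auto simp: source_symbol_def set_uniform_bits finite_bool_lists)

lemma finite_set_source_block: "Xs \<noteq> [] \<Longrightarrow> finite (set_pmf (source_block \<delta> Xs))"
  by (auto simp: source_block_def finite_set_edit set_pmf_of_set lessThan_empty_iff)

text \<open>With \<open>S = UNIV\<close> the cost of short chunks outside \<open>S\<close> disappears from the window cost.\<close>

lemma expect_window_cost_uniform:
  assumes "M > 0" "M \<le> n"
  shows "expect (uniform_bits (Suc n)) (window_cost \<kappa> n M UNIV) =
    no_marker_prob M n + real n / 2 ^ (M + 1) * no_marker_prob M (n - M) + \<kappa> / 2 ^ M"
proof -
  let ?u = "uniform_bits (Suc n)"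
  have fin: "finite (set_pmf ?u)"
    by (simp add: set_uniform_bits finite_bool_lists)
  have "{w. length w = Suc n \<and> suffix (marker M) w} = (\<lambda>u. u @ marker M) ` {u. length u = Suc n - M}"
    using assms by (auto simp: suffix_def image_iff)
  then have suf: "card {w. length w = Suc n \<and> suffix (marker M) w} = 2 ^ (Suc n - M)"
    by (simp add: card_image inj_on_def card_bool_lists)
  have "expect ?u (window_cost \<kappa> n M UNIV) =
    expect ?u (\<lambda>w. of_bool (\<not> sublist (marker M) (butlast w))) +
    real n * expect ?u (\<lambda>w. of_bool (\<not> sublist (marker M) (butlast w) \<and> suffix (marker M) w)) +
    \<kappa> * expect ?u (\<lambda>w. of_bool (suffix (marker M) w))"
    unfolding window_cost_def using fin by (simp add: expect_add del: of_bool_not_iff)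
  also have "\<dots> = no_marker_prob M n + real n / 2 ^ (M + 1) * no_marker_prob M (n - M) + \<kappa> / 2 ^ M"
  proof -
    have "(2 :: real) ^ Suc n = 2 ^ (M + 1) * 2 ^ (n - M)" "(2 :: real) ^ Suc n = 2 ^ (Suc n - M) * 2 ^ M"
      using assms by (simp_all add: power_add[symmetric] del: power_Suc)
    then show ?thesis
      unfolding expect_uniform_bits_of_bool card_butlast_no_marker card_first_marker_at_end[OF assms] suf
      by (simp add: no_marker_prob_def del: power_Suc) (simp add: field_simps)
  qed
  finally show ?thesis .
qed

lemma expect_block_cost_uniform:
  "expect (uniform_bits l) (block_cost \<kappa> n M UNIV) =
   real (l - n) * expect (uniform_bits (Suc n)) (window_cost \<kappa> n M UNIV)"
proof -
  let ?u = "uniform_bits l"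
  have fin: "finite (set_pmf ?u)"
    by (simp add: set_uniform_bits finite_bool_lists)
  have win: "expect ?u (\<lambda>Y. window_cost \<kappa> n M UNIV (take (Suc n) (drop i Y))) =
      expect (uniform_bits (Suc n)) (window_cost \<kappa> n M UNIV)" if "i < l - n" for i
  proof -
    have "uniform_bits (Suc n) = map_pmf (\<lambda>Y. take (Suc n) (drop i Y)) ?u"
      using that unfolding uniform_bits_eq_replicate_pmf by (intro map_window_replicate_pmf[symmetric]) auto
    then show ?thesis
      by simp
  qed
  have "expect ?u (block_cost \<kappa> n M UNIV) =
     expect ?u (\<lambda>Y. \<Sum>i<l - n. window_cost \<kappa> n M UNIV (take (Suc n) (drop i Y)))"
    by (intro expect_cong) (auto simp: block_cost_def set_uniform_bits)
  also have "\<dots> = (\<Sum>i<l - n. expect ?u (\<lambda>Y. window_cost \<kappa> n M UNIV (take (Suc n) (drop i Y))))"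
    by (rule expect_sum[OF fin])
  also have "\<dots> = (\<Sum>i<l - n. expect (uniform_bits (Suc n)) (window_cost \<kappa> n M UNIV))"
    by (intro sum.cong refl win) auto
  finally show ?thesis
    by simp
qed

lemma expect_block_cost_source_symbol_le:
  assumes "finite (set_pmf P)" "\<kappa> \<ge> 0"
  shows "expect (source_symbol P) (block_cost \<kappa> n M UNIV) \<le>
    expect P real * expect (uniform_bits (Suc n)) (window_cost \<kappa> n M UNIV)"
proof -
  let ?W = "expect (uniform_bits (Suc n)) (window_cost \<kappa> n M UNIV)"
  have W: "?W \<ge> 0"
    using assms by (intro integral_nonneg_AE) (simp add: window_cost_nonneg)
  have "expect (source_symbol P) (block_cost \<kappa> n M UNIV) = expect P (\<lambda>l. real (l - n) * ?W)"
    unfolding source_symbol_def using assms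
    by (subst expect_bind_pmf) (auto simp: set_uniform_bits finite_bool_lists expect_block_cost_uniform)
  also have "\<dots> \<le> expect P (\<lambda>l. real l * ?W)"
    using assms W by (intro expect_mono mult_right_mono) auto
  finally show ?thesis
    by simp
qed

section \<open>Cheap strings\<close>

text \<open>The strings that are entered into the dictionary at a negligible total cost: very short ones,
  and those of length at most \<open>n\<close> obtained from a window of a source symbol by few flips.\<close>

definition noisy_windows :: "real \<Rightarrow> nat \<Rightarrow> bool list \<Rightarrow> bool list set" where
  "noisy_windows \<gamma> n X =
     (\<Union>i<length X. \<Union>l\<le>n. (\<lambda>f. map2 (\<noteq>) (take l (drop i X)) f) ` few_flips \<gamma> l)"

definition cheap :: "real \<Rightarrow> nat \<Rightarrow> nat \<Rightarrow> bool list list \<Rightarrow> bool list set" where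
  "cheap \<gamma> l1 n Xs = {z. length z \<le> l1} \<union> (\<Union>X\<in>set Xs. noisy_windows \<gamma> n X)"

lemma finite_noisy_windows: "finite (noisy_windows \<gamma> n X)"
  by (auto simp: noisy_windows_def finite_few_flips)

lemma finite_short: "finite {z :: bool list. length z \<le> l}"
  using finite_lists_length_le[of "UNIV :: bool set" l] by simp

lemma finite_cheap: "finite (cheap \<gamma> l1 n Xs)"
  by (auto simp: cheap_def finite_noisy_windows finite_short)

lemma card_noisy_windows_le:
  assumes "0 < \<gamma>" "\<gamma> < 1 / 2"
  shows "real (card (noisy_windows \<gamma> n X)) \<le>
    real (length X) * (real n + 1) * 2 powr (real n * cross_entropy \<gamma> \<gamma>)"
proof -
  let ?w = "\<lambda>i l. (\<lambda>f. map2 (\<noteq>) (take l (drop i X)) f) ` few_flips \<gamma> l"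
  have h: "cross_entropy \<gamma> \<gamma> \<ge> 0"
    using assms by (intro cross_entropy_nonneg) auto
  have w: "real (card (?w i l)) \<le> 2 powr (real n * cross_entropy \<gamma> \<gamma>)" if "l \<le> n" for i l
  proof -
    have "real (card (?w i l)) \<le> real (card (few_flips \<gamma> l))"
      using card_image_le[OF finite_few_flips] by simp
    also have "\<dots> \<le> 2 powr (real l * cross_entropy \<gamma> \<gamma>)"
      by (rule card_few_flips_le[OF assms])
    also have "\<dots> \<le> 2 powr (real n * cross_entropy \<gamma> \<gamma>)"
      using that h by (intro powr_mono mult_right_mono) auto
    finally show ?thesis .
  qed
  have inner: "real (card (\<Union>l\<le>n. ?w i l)) \<le> (real n + 1) * 2 powr (real n * cross_entropy \<gamma> \<gamma>)" for i
  proof -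
    have "real (card (\<Union>l\<le>n. ?w i l)) \<le> real (\<Sum>l\<le>n. card (?w i l))"
      by (intro of_nat_mono card_UN_le) auto
    also have "\<dots> \<le> (\<Sum>l\<le>n. 2 powr (real n * cross_entropy \<gamma> \<gamma>))"
      unfolding of_nat_sum by (intro sum_mono) (use w in auto)
    finally show ?thesis
      by (simp add: add.commute)
  qed
  have "real (card (noisy_windows \<gamma> n X)) \<le> real (\<Sum>i<length X. card (\<Union>l\<le>n. ?w i l))"
    unfolding noisy_windows_def by (intro of_nat_mono card_UN_le) auto
  also have "\<dots> \<le> (\<Sum>i<length X. (real n + 1) * 2 powr (real n * cross_entropy \<gamma> \<gamma>))"
    unfolding of_nat_sum by (intro sum_mono inner)
  finally show ?thesis
    by (simp add: mult.assoc)
qed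

lemma sum_length_short_le:
  "(\<Sum>z\<in>{z :: bool list. length z \<le> l}. real (length z)) \<le> real l * 2 ^ (l + 1)"
proof -
  have card: "card {z :: bool list. length z \<le> l} \<le> 2 ^ (l + 1)"
  proof -
    have "card {z :: bool list. length z \<le> l} = (\<Sum>i\<le>l. 2 ^ i)"
      using card_lists_length_le[of "UNIV :: bool set" l] by (simp add: card_UNIV_bool)
    also have "\<dots> = (2 :: nat) ^ (l + 1) - 1"
      using sum_power2[of "Suc l"] by (simp add: atLeast0LessThan lessThan_Suc_atMost)
    finally show ?thesis
      by simp
  qed
  have "(\<Sum>z\<in>{z :: bool list. length z \<le> l}. real (length z)) \<le>
      real (card {z :: bool list. length z \<le> l}) * real l"
    by (rule sum_bounded_above) auto
  also have "\<dots> \<le> real (2 ^ (l + 1)) * real l"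
    using card by (intro mult_right_mono of_nat_mono) auto
  finally show ?thesis
    by (simp add: mult.commute)
qed

lemma sum_length_cheap_le:
  assumes "0 < \<gamma>" "\<gamma> < 1 / 2" and len: "\<And>X. X \<in> set Xs \<Longrightarrow> length X \<le> N"
  shows "(\<Sum>z\<in>cheap \<gamma> l1 n Xs. real (length z)) \<le>
    real l1 * 2 ^ (l1 + 1) +
    real n * (real (length Xs) * (real N * (real n + 1) * 2 powr (real n * cross_entropy \<gamma> \<gamma>)))"
proof -
  define U where "U = (\<Union>X\<in>set Xs. noisy_windows \<gamma> n X)"
  define b where "b = real N * (real n + 1) * 2 powr (real n * cross_entropy \<gamma> \<gamma>)"
  have finU: "finite U"
    by (auto simp: U_def finite_noisy_windows)
  have "real (card (noisy_windows \<gamma> n X)) \<le> b" if "X \<in> set Xs" for X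
  proof -
    have "real (length X) * ((real n + 1) * 2 powr (real n * cross_entropy \<gamma> \<gamma>)) \<le>
        real N * ((real n + 1) * 2 powr (real n * cross_entropy \<gamma> \<gamma>))"
      using len[OF that] by (intro mult_right_mono) auto
    then show ?thesis
      using card_noisy_windows_le[OF assms(1,2), of n X] unfolding b_def mult.assoc by linarith
  qed
  note b = this
  have "real (card U) \<le> real (\<Sum>X\<in>set Xs. card (noisy_windows \<gamma> n X))"
    unfolding U_def by (intro of_nat_mono card_UN_le) auto
  also have "\<dots> \<le> (\<Sum>X\<in>set Xs. b)"
    unfolding of_nat_sum by (intro sum_mono b)
  also have "\<dots> \<le> real (length Xs) * b"
    using card_length[of Xs] by (auto intro!: mult_right_mono simp: b_def)
  finally have card: "real (card U) \<le> real (length Xs) * b" .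
  have "length z \<le> n" if "z \<in> U" for z
    using that by (auto simp: U_def noisy_windows_def few_flips_def)
  then have "(\<Sum>z\<in>U. real (length z)) \<le> real (card U) * real n"
    by (intro sum_bounded_above) auto
  also have "\<dots> \<le> real n * (real (length Xs) * b)"
    using card by (simp add: mult.commute mult_left_mono)
  finally have "(\<Sum>z\<in>U. real (length z)) \<le> real n * (real (length Xs) * b)" .
  moreover have "(\<Sum>z\<in>cheap \<gamma> l1 n Xs. real (length z)) \<le>
      (\<Sum>z\<in>{z :: bool list. length z \<le> l1}. real (length z)) + (\<Sum>z\<in>U. real (length z))"
    unfolding cheap_def U_def[symmetric]
    using sum.union_inter[OF finite_short[of l1] finU, of "\<lambda>z. real (length z)"]
      sum_nonneg[of "{z. length z \<le> l1} \<inter> U" "\<lambda>z. real (length z)"] by simp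
  ultimately show ?thesis
    using sum_length_short_le[of l1] by (simp add: b_def)
qed

section \<open>Short chunks outside the cheap set\<close>

definition costly_windows :: "nat \<Rightarrow> bool list set \<Rightarrow> bool list \<Rightarrow> real" where
  "costly_windows n S Y =
     (\<Sum>i<length Y - n. of_bool (\<exists>z. suffix z (take (Suc n) (drop i Y)) \<and> length z \<le> n \<and> z \<notin> S))"

text \<open>This isolates the one term that depends on the source symbols through \<open>S\<close>;
  the rest can be averaged under the marginal law of a block.\<close>

lemma block_cost_split:
  "block_cost \<kappa> n M S Y = block_cost \<kappa> n M UNIV Y + real n * costly_windows n S Y"
  unfolding block_cost_def costly_windows_def sum_distrib_left sum.distrib[symmetric]
  by (intro sum.cong refl) (simp add: window_cost_def del: of_bool_eq_iff)

text \<open>Such a \<open>z\<close> is longer than \<open>l1\<close>, as all shorter strings are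
  cheap, and it is the exclusive or of a window of \<open>X\<close> with the flips at the same
  place; few flips there would make it a noisy window. Its last bit has position
  \<open>i + n\<close>, so it starts at \<open>i + Suc n - length z\<close>.\<close>

lemma costly_window_flips:
  assumes "X \<in> set Xs" "length f = length X" "i < length X - n"
    and z: "suffix z (take (Suc n) (drop i (map2 (\<noteq>) X f)))" "length z \<le> n" "z \<notin> cheap \<gamma> l1 n Xs"
  shows "\<exists>l\<in>{l1<..n}. take l (drop (i + Suc n - l) f) \<notin> few_flips \<gamma> l"
proof
  define l where "l = length z"
  define k where "k = i + Suc n - l"
  let ?w = "take (Suc n) (drop i (map2 (\<noteq>) X f))"
  have lw: "length ?w = Suc n"
    using assms by auto
  have "z = drop (Suc n - l) ?w"
    using z(1) lw unfolding suffix_def l_def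
    by (metis add_diff_cancel_right' append_eq_conv_conj length_append)
  also have "\<dots> = take l (drop k (map2 (\<noteq>) X f))"
    using z(2) by (simp add: drop_take l_def k_def add.commute)
  also have "\<dots> = map2 (\<noteq>) (take l (drop k X)) (take l (drop k f))"
    by (simp add: drop_map take_map drop_zip take_zip)
  finally have zeq: "z = map2 (\<noteq>) (take l (drop k X)) (take l (drop k f))" .
  have "l > l1"
    using z(3) by (auto simp: l_def cheap_def not_le)
  then have "k < length X" "l \<le> n"
    using assms(3) z(2) by (auto simp: k_def l_def)
  then show "take l (drop (i + Suc n - l) f) \<notin> few_flips \<gamma> l"
    using z(3) zeq assms(1) by (auto simp: cheap_def noisy_windows_def k_def)
  show "l \<in> {l1<..n}"
    using \<open>l > l1\<close> \<open>l \<le> n\<close> by simp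
qed

text \<open>Union bound over the position and the length of the offending suffix. All lengths exceed
  \<open>l1\<close>, which makes each failure exponentially rare in \<open>l1\<close>; very short
  strings show no such concentration and are exempt for that reason.\<close>

lemma expect_costly_windows_le:
  assumes \<delta>: "0 < \<delta>" "\<delta> < \<gamma>" "\<gamma> < 1" and X: "X \<in> set Xs"
    and D: "D = cross_entropy \<gamma> \<delta> - cross_entropy \<gamma> \<gamma>"
  shows "expect (edit \<delta> X) (costly_windows n (cheap \<gamma> l1 n Xs)) \<le>
    real (length X) * (real n * 2 powr (- (real l1 * D)))"
proof -
  let ?r = "replicate_pmf (length X) (bernoulli_pmf \<delta>)"
  let ?bad = "\<lambda>i l f. of_bool (take l (drop (i + Suc n - l) f) \<notin> few_flips \<gamma> l) :: real"
  have fin: "finite (set_pmf ?r)"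
    by (simp add: finite_set_replicate_pmf)
  have D0: "D \<ge> 0"
    unfolding D using cross_entropy_self_less[of \<gamma> \<delta>] \<delta> by simp
  have bad: "expect ?r (?bad i l) \<le> 2 powr (- (real l1 * D))"
    if "i < length X - n" "l \<in> {l1<..n}" for i l
  proof -
    have "expect ?r (?bad i l) = expect (map_pmf (\<lambda>f. take l (drop (i + Suc n - l) f)) ?r)
        (\<lambda>g. of_bool (g \<notin> few_flips \<gamma> l))"
      by simp
    also have "map_pmf (\<lambda>f. take l (drop (i + Suc n - l) f)) ?r = replicate_pmf l (bernoulli_pmf \<delta>)"
      using that by (intro map_window_replicate_pmf) auto
    also have "expect (replicate_pmf l (bernoulli_pmf \<delta>)) (\<lambda>g. of_bool (g \<notin> few_flips \<gamma> l)) =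
        measure_pmf.prob (replicate_pmf l (bernoulli_pmf \<delta>)) (- few_flips \<gamma> l)"
      unfolding expect_of_bool Compl_eq ..
    also have "\<dots> \<le> 2 powr (- (real l * D))"
      unfolding D by (rule prob_many_flips_le[OF \<delta>])
    also have "\<dots> \<le> 2 powr (- (real l1 * D))"
      using that D0 by (intro powr_mono) (auto intro!: mult_right_mono)
    finally show ?thesis .
  qed
  have "expect (edit \<delta> X) (costly_windows n (cheap \<gamma> l1 n Xs)) =
      expect ?r (\<lambda>f. costly_windows n (cheap \<gamma> l1 n Xs) (map2 (\<noteq>) X f))"
    by (simp add: edit_def)
  also have "\<dots> \<le> expect ?r (\<lambda>f. \<Sum>i<length X - n. \<Sum>l\<in>{l1<..n}. ?bad i l f)"
  proof (rule expect_mono[OF fin])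
    fix f assume "f \<in> set_pmf ?r"
    then have lf: "length f = length X"
      by (auto simp: set_replicate_pmf)
    have "costly_windows n (cheap \<gamma> l1 n Xs) (map2 (\<noteq>) X f) \<le> (\<Sum>i<length (map2 (\<noteq>) X f) - n. \<Sum>l\<in>{l1<..n}. ?bad i l f)"
      unfolding costly_windows_def
    proof (rule sum_mono)
      fix i assume i: "i \<in> {..<length (map2 (\<noteq>) X f) - n}"
      show "of_bool (\<exists>z. suffix z (take (Suc n) (drop i (map2 (\<noteq>) X f))) \<and> length z \<le> n \<and>
          z \<notin> cheap \<gamma> l1 n Xs) \<le> (\<Sum>l\<in>{l1<..n}. ?bad i l f)"
      proof (cases "\<exists>z. suffix z (take (Suc n) (drop i (map2 (\<noteq>) X f))) \<and> length z \<le> n \<and>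
          z \<notin> cheap \<gamma> l1 n Xs")
        case True
        then obtain z where z: "suffix z (take (Suc n) (drop i (map2 (\<noteq>) X f)))" "length z \<le> n"
            "z \<notin> cheap \<gamma> l1 n Xs"
          by blast
        have "i < length X - n"
          using i lf by simp
        from costly_window_flips[OF X lf this z]
        obtain l where l: "l \<in> {l1<..n}" "take l (drop (i + Suc n - l) f) \<notin> few_flips \<gamma> l"
          by blast
        have "1 = ?bad i l f"
          using l(2) by simp
        also have "\<dots> \<le> (\<Sum>l\<in>{l1<..n}. ?bad i l f)"
          by (rule member_le_sum) (use l(1) in auto)
        finally show ?thesis
          using True by simp
      next
        case False
        then show ?thesis
          by (simp only: of_bool_eq if_False) (simp add: sum_nonneg)
      qed
    qed
    then show "costly_windows n (cheap \<gamma> l1 n Xs) (map2 (\<noteq>) X f) \<le> (\<Sum>i<length X - n. \<Sum>l\<in>{l1<..n}. ?bad i l f)"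
      using lf by simp
  qed
  also have "\<dots> = (\<Sum>i<length X - n. \<Sum>l\<in>{l1<..n}. expect ?r (?bad i l))"
    by (simp only: expect_sum[OF fin])
  also have "\<dots> \<le> (\<Sum>i<length X - n. \<Sum>l\<in>{l1<..n}. 2 powr (- (real l1 * D)))"
    by (intro sum_mono bad) auto
  also have "\<dots> = real (length X - n) * (real (n - l1) * 2 powr (- (real l1 * D)))"
    by simp
  also have "\<dots> \<le> real (length X) * (real n * 2 powr (- (real l1 * D)))"
    by (intro mult_mono mult_right_mono) auto
  finally show ?thesis .
qed

section \<open>Expected length for fixed parameters\<close>

lemma source_symbol_support:
  assumes "x \<in> set_pmf (source_symbol P)"
  shows "length x \<in> set_pmf P"
  using assms by (auto simp: source_symbol_def set_uniform_bits)

lemma edit_length: "Y \<in> set_pmf (edit \<delta> X) \<Longrightarrow> length Y = length X"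
  by (auto simp: edit_def set_replicate_pmf)

lemma set_source_block:
  "Xs \<noteq> [] \<Longrightarrow> set_pmf (source_block \<delta> Xs) = (\<Union>X\<in>set Xs. set_pmf (edit \<delta> X))"
  by (auto simp: source_block_def set_pmf_of_set lessThan_empty_iff set_conv_nth)

lemma expect_source_block:
  assumes "Xs \<noteq> []"
  shows "expect (source_block \<delta> Xs) f = expect (pmf_of_set {..<length Xs}) (\<lambda>j. expect (edit \<delta> (Xs ! j)) f)"
  unfolding source_block_def using assms
  by (intro expect_bind_pmf) (auto simp: set_pmf_of_set lessThan_empty_iff finite_set_edit)

text \<open>Given the symbols \<open>Xs\<close>, the cheap set is fixed and the deterministic bound
  applies. The costly windows are bounded for each \<open>Xs\<close> separately; only the cost with
  \<open>UNIV\<close> is averaged over \<open>Xs\<close>.\<close>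

lemma expected_vld_length_le:
  assumes \<delta>: "0 < \<delta>" "\<delta> < \<gamma>" "\<gamma> < 1 / 2"
    and P: "\<And>l. l \<in> set_pmf P \<Longrightarrow> l \<le> N"
    and A: "A > 0" and BN: "B * N \<ge> 1" and M: "M > 0" "M \<le> n"
    and \<kappa>: "\<kappa> = 2 + log 2 (real (B * N))"
    and h: "h = cross_entropy \<gamma> \<gamma>" and D: "D = cross_entropy \<gamma> \<delta> - cross_entropy \<gamma> \<gamma>"
  shows "expect (source_stream A B \<delta> P) (\<lambda>s. real (vld_length M s)) \<le>
    real B * expect P real * (no_marker_prob M n +
      real n / 2 ^ (M + 1) * no_marker_prob M (n - M) + \<kappa> / 2 ^ M) +
    (2 * \<kappa> + (real l1 * 2 ^ (l1 + 1) +
        real n * (real A * (real N * (real n + 1) * 2 powr (real n * h)))) +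
      (\<kappa> + real n) + real B * (real n * (\<kappa> + real n + 1)) +
      real B * (real n * (real N * (real n * 2 powr (- (real l1 * D))))))"
proof -
  let ?Q = "source_symbol P"
  let ?R = "replicate_pmf A ?Q"
  let ?S = "cheap \<gamma> l1 n"
  define W where "W = no_marker_prob M n + real n / 2 ^ (M + 1) * no_marker_prob M (n - M) + \<kappa> / 2 ^ M"
  define G where "G = real N * (real n * 2 powr (- (real l1 * D)))"
  define T where "T = 2 * \<kappa> + (real l1 * 2 ^ (l1 + 1) +
        real n * (real A * (real N * (real n + 1) * 2 powr (real n * h)))) +
      (\<kappa> + real n) + real B * (real n * (\<kappa> + real n + 1))"
  have "log 2 (real (B * N)) \<ge> log 2 1"
    using BN by (intro log_mono) (auto simp del: of_nat_mult)
  then have \<kappa>0: "\<kappa> \<ge> 0"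
    by (simp add: \<kappa>)
  \<comment> \<open>Lengths are bounded by \<open>N\<close>, so all distributions have finite
    support and integrability is automatic.\<close>
  have finP: "finite (set_pmf P)"
    by (rule finite_subset[of _ "{..N}"]) (use P in auto)
  have finQ: "finite (set_pmf ?Q)"
    by (rule finite_set_source_symbol[OF finP])
  have finR: "finite (set_pmf ?R)"
    by (rule finite_set_replicate_pmf[OF finQ])
  have R: "Xs \<noteq> []" "length Xs = A" "\<And>X. X \<in> set Xs \<Longrightarrow> length X \<le> N" if "Xs \<in> set_pmf ?R" for Xs
    using that A P source_symbol_support by (auto simp: set_replicate_pmf)
  have finB: "finite (set_pmf (source_block \<delta> Xs))" if "Xs \<in> set_pmf ?R" for Xs
    using finite_set_source_block R(1)[OF that] by blast
  have stream: "expect (replicate_pmf B (source_block \<delta> Xs)) (\<lambda>Ys. real (vld_length M (concat Ys))) \<le>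
      T + real B * expect (source_block \<delta> Xs) (block_cost \<kappa> n M (?S Xs))" if Xs: "Xs \<in> set_pmf ?R" for Xs
  proof -
    let ?Ys = "replicate_pmf B (source_block \<delta> Xs)"
    have fin: "finite (set_pmf ?Ys)"
      by (rule finite_set_replicate_pmf[OF finB[OF Xs]])
    have S: "(\<Sum>z\<in>?S Xs. real (length z)) \<le> real l1 * 2 ^ (l1 + 1) +
        real n * (real A * (real N * (real n + 1) * 2 powr (real n * h)))"
      using sum_length_cheap_le[of \<gamma> Xs N l1 n] R[OF Xs] \<delta> by (simp add: h)
    have "expect ?Ys (\<lambda>Ys. real (vld_length M (concat Ys))) \<le>
        expect ?Ys (\<lambda>Ys. T + (\<Sum>Y\<leftarrow>Ys. block_cost \<kappa> n M (?S Xs) Y))"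
    proof (rule expect_mono[OF fin])
      fix Ys assume Ys: "Ys \<in> set_pmf ?Ys"
      then have B: "length Ys = B"
        by (auto simp: set_replicate_pmf)
      have "length Y \<le> N" if "Y \<in> set Ys" for Y
        using that Ys R[OF Xs] edit_length by (fastforce simp: set_replicate_pmf set_source_block)
      then have "length (concat Ys) \<le> B * N"
        using sum_list_mono[of Ys length "\<lambda>_. N"] B by (simp add: length_concat sum_list_triv)
      then show "real (vld_length M (concat Ys)) \<le> T + (\<Sum>Y\<leftarrow>Ys. block_cost \<kappa> n M (?S Xs) Y)"
        using vld_length_le[OF M(1) _ finite_cheap _ BN \<kappa>, of n Ys \<gamma> l1 n Xs] M S
        unfolding T_def B by simp
    qed
    also have "\<dots> = T + real B * expect (source_block \<delta> Xs) (block_cost \<kappa> n M (?S Xs))"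
      using fin by (simp add: expect_add expect_sum_list_replicate_pmf[OF finB[OF Xs]])
    finally show ?thesis .
  qed
  have block: "expect (source_block \<delta> Xs) (block_cost \<kappa> n M (?S Xs)) \<le>
      expect (source_block \<delta> Xs) (block_cost \<kappa> n M UNIV) + real n * G" if Xs: "Xs \<in> set_pmf ?R" for Xs
  proof -
    have "expect (source_block \<delta> Xs) (costly_windows n (?S Xs)) \<le> G"
      unfolding expect_source_block[OF R(1)[OF Xs]]
    proof (rule expect_le_const)
      fix j assume "j \<in> set_pmf (pmf_of_set {..<length Xs})"
      then have j: "Xs ! j \<in> set Xs"
        using R(1)[OF Xs] by (auto simp: set_pmf_of_set lessThan_empty_iff)
      have "expect (edit \<delta> (Xs ! j)) (costly_windows n (?S Xs)) \<le>
          real (length (Xs ! j)) * (real n * 2 powr (- (real l1 * D)))"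
        using \<delta> by (intro expect_costly_windows_le j D) auto
      also have "\<dots> \<le> G"
        unfolding G_def using R(3)[OF Xs j] by (intro mult_right_mono) auto
      finally show "expect (edit \<delta> (Xs ! j)) (costly_windows n (?S Xs)) \<le> G" .
    qed (use R(1)[OF Xs] in \<open>auto simp: set_pmf_of_set lessThan_empty_iff\<close>)
    then have "real n * expect (source_block \<delta> Xs) (costly_windows n (?S Xs)) \<le> real n * G"
      by (rule mult_left_mono) simp
    moreover have "block_cost \<kappa> n M (?S Xs) =
        (\<lambda>Y. block_cost \<kappa> n M UNIV Y + real n * costly_windows n (?S Xs) Y)"
      by (rule ext) (rule block_cost_split)
    then have "expect (source_block \<delta> Xs) (block_cost \<kappa> n M (?S Xs)) =
        expect (source_block \<delta> Xs) (block_cost \<kappa> n M UNIV) +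
        real n * expect (source_block \<delta> Xs) (costly_windows n (?S Xs))"
      using finB[OF Xs] by (simp add: expect_add)
    ultimately show ?thesis
      by linarith
  qed
  have mean: "expect ?R (\<lambda>Xs. expect (source_block \<delta> Xs) (block_cost \<kappa> n M UNIV)) \<le> expect P real * W"
    using expect_bind_pmf[OF finR, where f = "source_block \<delta>" and h = "block_cost \<kappa> n M UNIV"]
      expect_block_cost_source_symbol_le[OF finP \<kappa>0, of n M] finB
    by (simp add: bind_source_block[OF A] expect_window_cost_uniform[OF M] W_def)
  have finC: "finite (set_pmf (map_pmf concat (replicate_pmf B (source_block \<delta> Xs))))"
    if "Xs \<in> set_pmf ?R" for Xs
    using finite_set_replicate_pmf[OF finB[OF that]] by simp
  have "expect (source_stream A B \<delta> P) (\<lambda>s. real (vld_length M s)) =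
      expect ?R (\<lambda>Xs. expect (replicate_pmf B (source_block \<delta> Xs)) (\<lambda>Ys. real (vld_length M (concat Ys))))"
    unfolding source_stream_def using expect_bind_pmf[OF finR finC] by simp
  also have "\<dots> \<le> expect ?R (\<lambda>Xs. (T + real B * (real n * G)) +
      real B * expect (source_block \<delta> Xs) (block_cost \<kappa> n M UNIV))"
  proof (rule expect_mono[OF finR])
    fix Xs assume Xs: "Xs \<in> set_pmf ?R"
    show "expect (replicate_pmf B (source_block \<delta> Xs)) (\<lambda>Ys. real (vld_length M (concat Ys))) \<le>
        (T + real B * (real n * G)) + real B * expect (source_block \<delta> Xs) (block_cost \<kappa> n M UNIV)"
      using stream[OF Xs] mult_left_mono[OF block[OF Xs], of "real B"] by (simp add: distrib_left)
  qed
  also have "\<dots> = (T + real B * (real n * G)) +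
      real B * expect ?R (\<lambda>Xs. expect (source_block \<delta> Xs) (block_cost \<kappa> n M UNIV))"
    using finR by (simp add: expect_add)
  also have "\<dots> \<le> (T + real B * (real n * G)) + real B * (expect P real * W)"
    using mean by (intro add_left_mono mult_left_mono) auto
  finally show ?thesis
    by (simp add: T_def G_def W_def algebra_simps)
qed

section \<open>Asymptotics\<close>

text \<open>The terms of lower order, divided by \<open>B * L\<close>, as a function of \<open>x = log 2 B\<close>.\<close>

definition residual :: "real \<Rightarrow> real \<Rightarrow> real \<Rightarrow> real \<Rightarrow> real \<Rightarrow> real \<Rightarrow> real \<Rightarrow> real" where
  "residual H h k1 k2 c0 C x =
     (3 * (C + (1 + k1) * x) + (x / H + 1)) * 2 powr (- x) +
     x * 2 powr (x / 2) * 2 powr (- x) +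
     2 * 2 powr h * ((x / H + 1) * (x / H + 2)) * 2 powr (- (k2 * (1 - h / H) * x)) +
     (x / H + 1) * (C + (1 + k1) * x + x / H + 2) / (c0 * 2 powr (k1 * x)) +
     2 * (x / H + 1) ^ 2 * 2 powr (- ((x / 2 - 1) * (H - h)))"

lemma tendsto_residual:
  assumes "H > 0" "h < H" "k1 > 0" "k2 > 0" "c0 > 0"
  shows "((\<lambda>x. residual H h k1 k2 c0 C x) \<longlongrightarrow> 0) at_top"
proof -
  \<comment> \<open>The limits depend on these parameters only through their signs, so each gets a
    name and a sign.\<close>
  define e where "e = k2 * (1 - h / H)"
  have e: "e > 0"
    using assms by (auto simp: e_def field_simps)
  define D where "D = H - h"
  have D: "D > 0"
    using assms by (simp add: D_def)
  define q where "q = 1 / H"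
  have q: "q > 0"
    using assms by (simp add: q_def)
  have "((\<lambda>x. (3 * (C + (1 + k1) * x) + (x * q + 1)) * 2 powr (- x)) \<longlongrightarrow> 0) at_top"
    using q assms by real_asymp
  moreover have "((\<lambda>x::real. x * 2 powr (x / 2) * 2 powr (- x)) \<longlongrightarrow> 0) at_top"
    by real_asymp
  moreover have "((\<lambda>x. 2 * 2 powr h * ((x * q + 1) * (x * q + 2)) * 2 powr (- (e * x))) \<longlongrightarrow> 0) at_top"
    using q e by real_asymp
  moreover have "((\<lambda>x. (x * q + 1) * (C + (1 + k1) * x + x * q + 2) / (c0 * 2 powr (k1 * x))) \<longlongrightarrow> 0) at_top"
    using q assms by real_asymp
  moreover have "((\<lambda>x. 2 * (x * q + 1) ^ 2 * 2 powr (- ((x / 2 - 1) * D))) \<longlongrightarrow> 0) at_top"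
    using q D by real_asymp
  ultimately have "((\<lambda>x. (3 * (C + (1 + k1) * x) + (x * q + 1)) * 2 powr (- x) +
     x * 2 powr (x / 2) * 2 powr (- x) +
     2 * 2 powr h * ((x * q + 1) * (x * q + 2)) * 2 powr (- (e * x)) +
     (x * q + 1) * (C + (1 + k1) * x + x * q + 2) / (c0 * 2 powr (k1 * x)) +
     2 * (x * q + 1) ^ 2 * 2 powr (- ((x / 2 - 1) * D))) \<longlongrightarrow> 0 + 0 + 0 + 0 + 0) at_top"
    by (intro tendsto_add)
  then show ?thesis
    by (simp add: residual_def e_def D_def q_def)
qed

text \<open>The five summands \<open>t1\<close> to \<open>t5\<close> are: one-time costs, very short
  strings, noisy windows, flat charges at block starts, and costly windows.\<close>

lemma residual_bound:
  fixes A B N n l1 :: nat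
  assumes H: "H > 0" "0 \<le> h" "h < H" and k1: "k1 > 0" and c0: "c0 > 0"
    and B: "B \<ge> 1" and A: "A \<ge> 1" "real A \<le> real B powr (1 - k2)"
    and L: "L \<ge> 1" "c0 * real B powr k1 \<le> L" and N: "real N \<le> 2 * L"
    and x: "x = log 2 (real B)"
    and n: "real n \<le> log 2 (real B / real A) / H + 1"
    and \<kappa>: "0 \<le> \<kappa>" "\<kappa> \<le> C + (1 + k1) * x"
    and l1: "real l1 \<le> x / 2" "x / 2 - 1 \<le> real l1"
  shows "2 * \<kappa> + (real l1 * 2 ^ (l1 + 1) +
        real n * (real A * (real N * (real n + 1) * 2 powr (real n * h)))) +
      (\<kappa> + real n) + real B * (real n * (\<kappa> + real n + 1)) +
      real B * (real n * (real N * (real n * 2 powr (- (real l1 * (H - h)))))) \<le>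
    real B * L * residual H h k1 k2 c0 C x"
proof -
  define K where "K = C + (1 + k1) * x"
  define m where "m = x / H + 1"
  define y where "y = real B / real A"
  have y: "y > 0"
    using A B by (simp add: y_def)
  have BL: "real B * L \<ge> 0" "real B > 0" "L > 0"
    using B L by auto
  have powx: "2 powr x = real B"
    using B by (simp add: x)
  have powk: "2 powr (k1 * x) = real B powr k1"
    unfolding powx[symmetric] powr_powr by (simp add: mult.commute)
  have "log 2 y \<le> x"
    unfolding x y_def using A B by (intro log_mono) (auto simp: field_simps)
  then have nm: "real n \<le> m"
    using n H by (simp add: m_def y_def) (meson add_mono divide_right_mono less_imp_le order.refl order_trans)
  have x0: "x \<ge> 0"
    using l1 by linarith
  have m0: "m \<ge> 0"
    using nm by linarith
  have K: "\<kappa> \<le> K"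
    using \<kappa> by (simp add: K_def)
  have t1: "3 * \<kappa> + real n \<le> real B * L * ((3 * K + m) * 2 powr (- x))"
  proof -
    have "3 * \<kappa> + real n \<le> 1 * (3 * K + m)"
      using K nm by simp
    also have "\<dots> \<le> L * (3 * K + m)"
      using L K \<kappa> m0 by (intro mult_right_mono) auto
    also have "\<dots> = real B * L * ((3 * K + m) * 2 powr (- x))"
      using BL by (simp add: powr_minus powx field_simps)
    finally show ?thesis .
  qed
  have t2: "real l1 * 2 ^ (l1 + 1) \<le> real B * L * (x * 2 powr (x / 2) * 2 powr (- x))"
  proof -
    \<comment> \<open>With \<open>l1\<close> about half of \<open>log 2 B\<close>, the exempt short
      strings number only of the order of \<open>sqrt B\<close>, while the failure probability in
      \<open>t5\<close> is still at most of the order of a negative power of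
      \<open>B\<close>.\<close>
    have "(2 :: real) ^ l1 \<le> 2 powr (x / 2)"
      unfolding powr_realpow[symmetric, OF zero_less_numeral] using l1 by (intro powr_mono) auto
    then have "real l1 * 2 ^ (l1 + 1) \<le> (x / 2) * (2 * 2 powr (x / 2))"
      using l1 x0 by (intro mult_mono) auto
    also have "\<dots> \<le> L * (x * 2 powr (x / 2))"
      using mult_right_mono[OF L(1), of "x * 2 powr (x / 2)"] x0 by simp
    also have "\<dots> = real B * L * (x * 2 powr (x / 2) * 2 powr (- x))"
      using BL by (simp add: powr_minus powx field_simps)
    finally show ?thesis .
  qed
  have t3: "real n * (real A * (real N * (real n + 1) * 2 powr (real n * h))) \<le>
      real B * L * (2 * 2 powr h * (m * (m + 1)) * 2 powr (- (k2 * (1 - h / H) * x)))"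
  proof -
    \<comment> \<open>The choice of \<open>n\<close> gives
      \<open>A * 2 powr (n * h) \<le> 2 powr h * A * y powr (h / H)\<close>, and
      \<open>A * y = B\<close> turns the right side into
      \<open>2 powr h * B * y powr (- (1 - h / H))\<close>.\<close>
    have "2 powr (real n * h) \<le> 2 powr ((log 2 y / H + 1) * h)"
      using n H by (intro powr_mono mult_right_mono) (auto simp: y_def)
    also have "\<dots> = 2 powr h * y powr (h / H)"
    proof -
      have "(log 2 y / H + 1) * h = h + log 2 y * (h / H)"
        by (simp add: field_simps)
      then show ?thesis
        using y by (simp only: powr_add powr_powr[symmetric] powr_log_cancel)
    qed
    finally have "real A * 2 powr (real n * h) \<le> real A * (2 powr h * y powr (h / H))"
      by (rule mult_left_mono) simp
    also have "\<dots> = real B * (2 powr h * y powr (- (1 - h / H)))"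
    proof -
      have "y powr (h / H) = y * y powr (- (1 - h / H))"
        using y by (subst powr_mult_base) auto
      then show ?thesis
        using A by (simp add: y_def)
    qed
    also have "\<dots> \<le> real B * (2 powr h * (2 powr (k2 * x)) powr (- (1 - h / H)))"
    proof -
      \<comment> \<open>The bound on \<open>A\<close> makes \<open>y\<close> at least
        \<open>B powr k2\<close>, so a power of \<open>B\<close> is gained.\<close>
      have "real A * real B powr k2 \<le> real B powr (1 - k2) * real B powr k2"
        using A by (intro mult_right_mono) auto
      also have "\<dots> = real B"
        using B by (simp add: powr_add[symmetric])
      finally have "real B powr k2 \<le> y"
        using A by (simp add: y_def field_simps)
      moreover have "2 powr (k2 * x) = real B powr k2"
        unfolding powx[symmetric] powr_powr by (simp add: mult.commute)
      ultimately have "2 powr (k2 * x) \<le> y"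
        by simp
      then have "y powr (- (1 - h / H)) \<le> (2 powr (k2 * x)) powr (- (1 - h / H))"
        using H by (intro powr_mono2') auto
      then show ?thesis
        by (intro mult_left_mono) auto
    qed
    also have "\<dots> = real B * (2 powr h * 2 powr (- (k2 * (1 - h / H) * x)))"
      by (simp add: powr_powr algebra_simps)
    finally have AB: "real A * 2 powr (real n * h) \<le>
        real B * (2 powr h * 2 powr (- (k2 * (1 - h / H) * x)))" .
    have "real n * (real A * (real N * (real n + 1) * 2 powr (real n * h))) =
        (real n * (real n + 1)) * real N * (real A * 2 powr (real n * h))"
      by (simp add: mult_ac)
    also have "\<dots> \<le> (m * (m + 1)) * (2 * L) * (real B * (2 powr h * 2 powr (- (k2 * (1 - h / H) * x))))"
      using nm N m0 BL by (intro mult_mono AB) auto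
    finally show ?thesis
      by (simp only: mult_ac)
  qed
  have t4: "real B * (real n * (\<kappa> + real n + 1)) \<le>
      real B * L * (m * (K + m + 1) / (c0 * 2 powr (k1 * x)))"
  proof -
    \<comment> \<open>The flat charge per block is polynomial in \<open>log B\<close>, whereas
      \<open>L\<close> grows at least like \<open>B powr k1\<close>.\<close>
    have c: "c0 * 2 powr (k1 * x) > 0" "c0 * 2 powr (k1 * x) \<le> L"
      using c0 L B by (simp_all add: powk)
    have "real n * (\<kappa> + real n + 1) \<le> m * (K + m + 1)"
      using nm m0 K \<kappa> by (intro mult_mono) auto
    also have "\<dots> \<le> L / (c0 * 2 powr (k1 * x)) * (m * (K + m + 1))"
      using c m0 K \<kappa> mult_right_mono[of 1 "L / (c0 * 2 powr (k1 * x))" "m * (K + m + 1)"]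
      by (simp add: le_divide_eq)
    finally have "real B * (real n * (\<kappa> + real n + 1)) \<le>
        real B * (L / (c0 * 2 powr (k1 * x)) * (m * (K + m + 1)))"
      by (rule mult_left_mono) simp
    then show ?thesis
      by simp
  qed
  have t5: "real B * (real n * (real N * (real n * 2 powr (- (real l1 * (H - h)))))) \<le>
      real B * L * (2 * m ^ 2 * 2 powr (- ((x / 2 - 1) * (H - h))))"
  proof -
    have "2 powr (- (real l1 * (H - h))) \<le> 2 powr (- ((x / 2 - 1) * (H - h)))"
      using l1 H by (intro powr_mono) (auto intro!: mult_right_mono)
    then have "(real n * real n) * real N * 2 powr (- (real l1 * (H - h))) \<le>
        (m * m) * (2 * L) * 2 powr (- ((x / 2 - 1) * (H - h)))"
      using nm m0 N BL by (intro mult_mono) auto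
    then have "real B * ((real n * real n) * real N * 2 powr (- (real l1 * (H - h)))) \<le>
        real B * ((m * m) * (2 * L) * 2 powr (- ((x / 2 - 1) * (H - h))))"
      by (rule mult_left_mono) simp
    then show ?thesis
      by (simp add: mult_ac power2_eq_square)
  qed
  have "residual H h k1 k2 c0 C x = (3 * K + m) * 2 powr (- x) + x * 2 powr (x / 2) * 2 powr (- x) +
      2 * 2 powr h * (m * (m + 1)) * 2 powr (- (k2 * (1 - h / H) * x)) +
      m * (K + m + 1) / (c0 * 2 powr (k1 * x)) + 2 * m ^ 2 * 2 powr (- ((x / 2 - 1) * (H - h)))"
    by (simp add: residual_def K_def m_def add.assoc)
  then show ?thesis
    unfolding distrib_left using t1 t2 t3 t4 t5 by (simp only: distrib_left)
qed

text \<open>Since \<open>2 * M \<le> 2 ^ (M + 1)\<close>, a loss of \<open>2 * M\<close> bits lowers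
  the exponent by at most 1, a factor \<open>exp 1 \<le> 3\<close>. The hypothesis is shaped to
  cover both \<open>m = n\<close> and \<open>m = n - M\<close>.\<close>

lemma no_marker_prob_le_exp_ratio:
  assumes "M > 0" "c * 2 ^ (M + 1) \<le> real m + real M"
  shows "no_marker_prob M m \<le> 3 * exp (- c)"
proof -
  have "(c - 1) * 2 ^ (M + 1) \<le> real m - real M"
    using assms(2) of_nat_less_two_power[of M, where 'a = real]
    by (simp only: left_diff_distrib power_add power_one_right)
  then have "c - 1 \<le> (real m - real M) / 2 ^ (M + 1)"
    by (simp only: pos_le_divide_eq zero_less_power zero_less_numeral)
  then have "exp (- (real m - real M) / 2 ^ (M + 1)) \<le> exp (1 - c)"
    unfolding exp_le_cancel_iff minus_divide_left[symmetric] by linarith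
  also have "\<dots> = exp 1 * exp (- c)"
    by (simp add: exp_add[symmetric])
  also have "\<dots> \<le> 3 * exp (- c)"
    using exp_le by (intro mult_right_mono) auto
  finally show ?thesis
    using no_marker_prob_le_exp[OF assms(1), of m] by linarith
qed

lemma expected_vld_length_bound:
  fixes A B M :: nat
  assumes \<delta>: "0 < \<delta>" "\<delta> < \<gamma>" "\<gamma> < 1 / 2"
    and k1: "k1 > 0" and k2: "k2 > 0" and c0: "c0 > 0" and C1: "C1 > 0"
    and H: "H = cross_entropy \<gamma> \<delta>" and h: "h = cross_entropy \<gamma> \<gamma>"
    and B: "B > 0" and A: "A > 0" "real A \<le> real B powr (1 - k2)"
    and P: "\<And>l. l \<in> set_pmf P \<Longrightarrow> real l \<le> 2 * L" "expect P real = L"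
    and L: "L \<ge> 1" "c0 * real B powr k1 \<le> L" "L \<le> C1 * real B powr k1"
    and c: "c = log 2 (real B / real A) / (H * 2 ^ (M + 1))" "c \<ge> c'" "c' > 0"
    and M: "M > 0" "real M \<le> c' * 2 ^ (M + 1)"
    and small: "(3 + log 2 C1) / 2 ^ M + residual H h k1 k2 c0 (3 + log 2 C1) (log 2 (real B)) \<le>
      2 * H * ((1 + k1) / k2) * c'"
  shows "expect (source_stream A B \<delta> P) (\<lambda>s. real (vld_length M s)) \<le>
    (12 * exp (- c) * (c + 1) + 4 * H * ((1 + k1) / k2) * c) * (real B * L)"
proof -
  define x where "x = log 2 (real B)"
  define n where "n = nat \<lceil>c * 2 ^ (M + 1)\<rceil>"
  define N where "N = nat \<lfloor>2 * L\<rfloor>"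
  define l1 where "l1 = nat \<lfloor>x / 2\<rfloor>"
  define \<kappa> where "\<kappa> = 2 + log 2 (real (B * N))"
  define C where "C = 3 + log 2 C1"
  define q where "q = 2 * H * ((1 + k1) / k2)"
  have h0: "h \<ge> 0" "h < H"
    using \<delta> cross_entropy_self_less[of \<gamma> \<delta>] cross_entropy_nonneg[of \<gamma> \<gamma>] by (auto simp: h H)
  then have H0: "H > 0"
    by simp
  have q0: "q > 0"
    using H0 k1 k2 by (simp add: q_def)
  have c0': "c > 0"
    using c by simp
  have y: "log 2 (real B / real A) = c * 2 ^ (M + 1) * H"
    using H0 by (simp add: c(1))
  have n: "c * 2 ^ (M + 1) \<le> real n" "real n \<le> c * 2 ^ (M + 1) + 1"
    using c0' of_int_ceiling_le_add_one[of "c * 2 ^ (M + 1)"] unfolding n_def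
    by (auto simp: real_nat_ceiling_ge)
  have "c' * 2 ^ (M + 1) \<le> c * 2 ^ (M + 1)"
    using c by (intro mult_right_mono) auto
  then have Mn: "M \<le> n"
    using M(2) n(1) by linarith
  have N: "real N \<le> 2 * L" "N \<ge> 1"
    using L(1) by (auto simp: N_def le_nat_floor)
  have PN: "l \<le> N" if "l \<in> set_pmf P" for l
    using P(1)[OF that] by (simp add: N_def le_nat_floor)
  have BN: "B * N \<ge> 1"
    using B N by simp
  have "log 2 (real (B * N)) \<ge> log 2 1"
    using BN by (intro log_mono) (auto simp del: of_nat_mult)
  then have \<kappa>0: "\<kappa> \<ge> 0"
    by (simp add: \<kappa>_def)
  have \<kappa>: "\<kappa> \<le> C + (1 + k1) * x"
  proof -
    have "real (B * N) \<le> real B * (2 * (C1 * real B powr k1))"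
      using N(1) L(3) by (simp add: mult_left_mono)
    also have "\<dots> = 2 * C1 * real B powr (1 + k1)"
      using B by (simp add: powr_add)
    finally have "log 2 (real (B * N)) \<le> log 2 (2 * C1 * real B powr (1 + k1))"
      using BN by (intro log_mono) (auto simp del: of_nat_mult)
    also have "\<dots> = 1 + log 2 C1 + (1 + k1) * x"
      using C1 B by (simp add: log_mult log_powr x_def)
    finally show ?thesis
      by (simp add: \<kappa>_def C_def)
  qed
  have x0: "x \<ge> 0"
    using B by (simp add: x_def zero_le_log_cancel_iff)
  have l1: "real l1 \<le> x / 2" "x / 2 - 1 \<le> real l1"
    using x0 unfolding l1_def by (auto simp: of_nat_nat) linarith
  \<comment> \<open>This is \<open>k2 * log B \<le> log (B / A)\<close>. It converts the
    \<open>(1 + k1) * log B\<close> bits of a pointer into a multiple of \<open>c\<close> and is the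
    origin of the factor \<open>(1 + k1) / k2\<close>.\<close>
  have kx: "k2 * x \<le> c * 2 ^ (M + 1) * H"
  proof -
    have "log 2 (real A) \<le> (1 - k2) * x"
      using A B log_mono[of 2 "real A" "real B powr (1 - k2)"] by (simp add: log_powr x_def)
    then show ?thesis
      unfolding y[symmetric] using A B by (simp add: log_divide x_def algebra_simps)
  qed
  define p where "p = no_marker_prob M n + real n / 2 ^ (M + 1) * no_marker_prob M (n - M)"
  have p: "p \<le> 12 * exp (- c) * (c + 1)"
  proof -
    have "no_marker_prob M n \<le> 3 * exp (- c)"
      using n by (intro no_marker_prob_le_exp_ratio M) auto
    moreover have "no_marker_prob M (n - M) \<le> 3 * exp (- c)"
      using n Mn by (intro no_marker_prob_le_exp_ratio M) (auto simp: of_nat_diff)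
    moreover have "real n / 2 ^ (M + 1) \<le> c + 1"
    proof -
      have "real n \<le> c * 2 ^ (M + 1) + 1 * 2 ^ (M + 1)"
        using n(2) one_le_power[of "2 :: real" "M + 1"] by linarith
      then show ?thesis
        by (simp only: divide_le_eq zero_less_power zero_less_numeral if_True distrib_right)
    qed
    ultimately have "p \<le> 3 * exp (- c) + (c + 1) * (3 * exp (- c))"
      unfolding p_def using c0' by (intro add_mono mult_mono) (auto simp: no_marker_prob_def)
    also have "\<dots> = exp (- c) * (3 * c + 6)"
      by (simp add: algebra_simps)
    also have "\<dots> \<le> exp (- c) * (12 * (c + 1))"
      using c0' by (intro mult_left_mono) auto
    finally show ?thesis
      by (simp only: mult_ac)
  qed
  have pointers: "\<kappa> / 2 ^ M \<le> C / 2 ^ M + q * c"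
  proof -
    have "(1 + k1) * x = (1 + k1) / k2 * (k2 * x)"
      using k2 by simp
    also have "\<dots> \<le> (1 + k1) / k2 * (c * 2 ^ (M + 1) * H)"
      using kx k1 k2 by (intro mult_left_mono) auto
    finally have "\<kappa> \<le> C + (1 + k1) / k2 * (c * 2 ^ (M + 1) * H)"
      using \<kappa> by linarith
    then have "\<kappa> / 2 ^ M \<le> (C + (1 + k1) / k2 * (c * 2 ^ (M + 1) * H)) / 2 ^ M"
      by (rule divide_right_mono) simp
    then show ?thesis
      by (simp add: q_def add_divide_distrib mult_ac)
  qed
  have qc: "q * c' \<le> q * c"
    using c(2) q0 by (intro mult_left_mono) auto
  have qq: "4 * H * ((1 + k1) / k2) * c = q * c + q * c"
    by (simp add: q_def)
  \<comment> \<open>The budget for pointers is \<open>2 * q * c\<close>, of which they use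
    \<open>q * c\<close>. The vanishing terms are at most \<open>q * c'\<close>, hence fit into the
    other half.\<close>
  have add_up: "a + b + d \<le> e + f"
    if "b \<le> u + v" "w \<le> v" "f = v + v" "u + d \<le> w" "a \<le> e" for a b d e f u v w :: real
    using that by linarith
  have total: "p + \<kappa> / 2 ^ M + residual H h k1 k2 c0 C x \<le>
      12 * exp (- c) * (c + 1) + 4 * H * ((1 + k1) / k2) * c"
    using small unfolding C_def[symmetric] x_def[symmetric] q_def[symmetric]
    by (rule add_up[OF pointers qc qq _ p])
  have "expect (source_stream A B \<delta> P) (\<lambda>s. real (vld_length M s)) \<le>
     real B * L * (p + \<kappa> / 2 ^ M) + real B * L * residual H h k1 k2 c0 C x"
  proof (rule order_trans)
    show "expect (source_stream A B \<delta> P) (\<lambda>s. real (vld_length M s)) \<le>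
    real B * expect P real * (no_marker_prob M n +
      real n / 2 ^ (M + 1) * no_marker_prob M (n - M) + \<kappa> / 2 ^ M) +
    (2 * \<kappa> + (real l1 * 2 ^ (l1 + 1) +
        real n * (real A * (real N * (real n + 1) * 2 powr (real n * h)))) +
      (\<kappa> + real n) + real B * (real n * (\<kappa> + real n + 1)) +
      real B * (real n * (real N * (real n * 2 powr (- (real l1 * (H - h)))))))"
      by (rule expected_vld_length_le[OF \<delta> PN A(1) BN M(1) Mn \<kappa>_def h]) (simp_all add: H h)
    have nH: "real n \<le> log 2 (real B / real A) / H + 1"
      using n(2) H0 by (simp add: y)
    show "real B * expect P real * (no_marker_prob M n +
      real n / 2 ^ (M + 1) * no_marker_prob M (n - M) + \<kappa> / 2 ^ M) +
    (2 * \<kappa> + (real l1 * 2 ^ (l1 + 1) +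
        real n * (real A * (real N * (real n + 1) * 2 powr (real n * h)))) +
      (\<kappa> + real n) + real B * (real n * (\<kappa> + real n + 1)) +
      real B * (real n * (real N * (real n * 2 powr (- (real l1 * (H - h)))))))
      \<le> real B * L * (p + \<kappa> / 2 ^ M) + real B * L * residual H h k1 k2 c0 C x"
      unfolding P(2) p_def
      by (intro add_left_mono residual_bound[OF H0 h0 k1 c0 _ _ A(2) L(1,2) N(1) x_def nH \<kappa>0 \<kappa> l1])
        (use B A in auto)
  qed
  also have "\<dots> = (p + \<kappa> / 2 ^ M + residual H h k1 k2 c0 C x) * (real B * L)"
    by (simp add: algebra_simps)
  also have "\<dots> \<le> (12 * exp (- c) * (c + 1) + 4 * H * ((1 + k1) / k2) * c) * (real B * L)"
    using total L by (intro mult_right_mono) auto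
  finally show ?thesis .
qed

theorem theorem18:
  fixes \<delta> \<gamma> k1 k2 :: real
    and A M :: "nat \<Rightarrow> nat"
    and L :: "nat \<Rightarrow> real"
    and P :: "nat \<Rightarrow> nat pmf"
    and c :: "nat \<Rightarrow> real"
  assumes delta: "0 < \<delta>" "\<delta> < 1/2"
    and gamma: "\<delta> < \<gamma>" "\<gamma> < 1/2"
    and k1: "0 < k1"
    and k2: "0 < k2" "k2 < 1"
    and A_pos: "\<And>B. B > 0 \<Longrightarrow> A B > 0"
    and A_lim: "filterlim A at_top sequentially"
    and A_le: "eventually (\<lambda>B. real (A B) \<le> real B powr (1 - k2)) sequentially"
    and P_pos: "\<And>B. B > 0 \<Longrightarrow> set_pmf (P B) \<subseteq> {0<..}"
    and P_supp: "\<And>B. B > 0 \<Longrightarrow> real ` set_pmf (P B) \<subseteq> {L B / 2 .. 2 * L B}"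
    and P_mean: "\<And>B. B > 0 \<Longrightarrow> measure_pmf.expectation (P B) real = L B"
    and L_lim: "filterlim L at_top sequentially"
    and L_Theta: "L \<in> \<Theta>(\<lambda>B. real B powr k1)"
    and M_Theta: "(\<lambda>B. 2 ^ M B :: real) \<in> \<Theta>(\<lambda>B. log 2 (real B / real (A B)))"
    and c_def: "\<And>B. c B = log 2 (real B / real (A B)) / (cross_entropy \<gamma> \<delta> * 2 ^ (M B + 1))"
  shows "\<exists>\<epsilon> :: nat \<Rightarrow> real. \<epsilon> \<longlonglongrightarrow> 0 \<and>
    eventually (\<lambda>B.
      measure_pmf.expectation (source_stream (A B) B \<delta> (P B)) (\<lambda>s. real (vld_length (M B) s))
        \<le> (12 * exp (- c B) * (c B + 1) + 4 * cross_entropy \<gamma> \<delta> * ((1 + k1) / k2) * c B)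
           * (real B * L B) * (1 + \<epsilon> B)) sequentially"
proof -
  define H where "H = cross_entropy \<gamma> \<delta>"
  define h where "h = cross_entropy \<gamma> \<gamma>"
  have h: "0 \<le> h" "h < H"
    using delta gamma cross_entropy_self_less[of \<gamma> \<delta>] cross_entropy_nonneg[of \<gamma> \<gamma>]
    by (auto simp: h_def H_def)
  then have H: "H > 0"
    by simp
  have B0: "eventually (\<lambda>B :: nat. B > 0) sequentially"
    by (rule eventually_gt_at_top)
  obtain C1 where C1: "C1 > 0" "eventually (\<lambda>B. norm (L B) \<le> C1 * norm (real B powr k1)) sequentially"
    using bigthetaD1[OF L_Theta] by (rule landau_o.bigE)
  obtain c0 where c0: "c0 > 0" "eventually (\<lambda>B. norm (L B) \<ge> c0 * norm (real B powr k1)) sequentially"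
    using bigthetaD2[OF L_Theta] by (rule landau_omega.bigE)
  obtain a2 where a2: "a2 > 0"
    "eventually (\<lambda>B. norm (2 ^ M B :: real) \<le> a2 * norm (log 2 (real B / real (A B)))) sequentially"
    using bigthetaD1[OF M_Theta] by (rule landau_o.bigE)
  obtain a1 where a1: "a1 > 0"
    "eventually (\<lambda>B. norm (2 ^ M B :: real) \<ge> a1 * norm (log 2 (real B / real (A B)))) sequentially"
    using bigthetaD2[OF M_Theta] by (rule landau_omega.bigE)
  \<comment> \<open>Inserting \<open>2 ^ M \<le> a2 * log (B / A)\<close> into the definition of
    \<open>c\<close> gives exactly this lower bound.\<close>
  define c' where "c' = 1 / (2 * H * a2)"
  have c': "c' > 0"
    using H a2 by (simp add: c'_def)
  have x_lim: "filterlim (\<lambda>B. log 2 (real B)) at_top sequentially"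
    by real_asymp
  have y_ge: "eventually (\<lambda>B. k2 * log 2 (real B) \<le> log 2 (real B / real (A B))) sequentially"
    using A_le B0
  proof eventually_elim
    case (elim B)
    have "log 2 (real (A B)) \<le> (1 - k2) * log 2 (real B)"
      using elim A_pos[of B] log_mono[of 2 "real (A B)" "real B powr (1 - k2)"] by (simp add: log_powr)
    then show ?case
      using elim A_pos[of B] by (simp add: log_divide algebra_simps)
  qed
  have x_pos: "eventually (\<lambda>B. log 2 (real B) > 0) sequentially"
    using x_lim by (simp add: filterlim_at_top_dense)
  \<comment> \<open>The other half of the Theta bound, with
    \<open>log (B / A) \<ge> k2 * log B\<close>, forces the marker length to infinity.\<close>
  have pow_lim: "filterlim (\<lambda>B. 2 ^ M B :: real) at_top sequentially"
  proof (rule filterlim_at_top_mono)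
    show "filterlim (\<lambda>B. a1 * k2 * log 2 (real B)) at_top sequentially"
      using a1 k2 by (intro filterlim_tendsto_pos_mult_at_top[OF tendsto_const _ x_lim]) auto
    show "eventually (\<lambda>B. a1 * k2 * log 2 (real B) \<le> 2 ^ M B) sequentially"
      using a1(2) y_ge x_pos
    proof eventually_elim
      case (elim B)
      have "a1 * (k2 * log 2 (real B)) \<le> a1 * norm (log 2 (real B / real (A B)))"
        using elim a1(1) by (intro mult_left_mono) auto
      then show ?case
        using elim by (simp add: mult.assoc)
    qed
  qed
  have M_lim: "filterlim M at_top sequentially"
    unfolding filterlim_at_top
  proof
    fix Z :: nat
    have "eventually (\<lambda>B. (2 :: real) ^ Z \<le> 2 ^ M B) sequentially"
      using pow_lim unfolding filterlim_at_top by blast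
    then show "eventually (\<lambda>B. Z \<le> M B) sequentially"
      by eventually_elim simp
  qed
  have M_pos: "eventually (\<lambda>B. M B > 0) sequentially"
    using M_lim by (rule eventually_compose_filterlim[OF eventually_gt_at_top])
  \<comment> \<open>This yields \<open>M \<le> n\<close>, so that a marker fits into a
    window.\<close>
  have M_le: "eventually (\<lambda>B. real (M B) \<le> c' * 2 ^ (M B + 1)) sequentially"
  proof -
    have "eventually (\<lambda>m :: nat. real m \<le> c' * 2 ^ (m + 1)) at_top"
      using c' by real_asymp
    then show ?thesis
      using M_lim by (rule eventually_compose_filterlim)
  qed
  have c_ge: "eventually (\<lambda>B. c' \<le> c B) sequentially"
    using a2(2) y_ge x_pos
  proof eventually_elim
    case (elim B)
    have "log 2 (real B / real (A B)) > 0"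
      using elim k2 by (meson less_le_trans mult_pos_pos)
    with elim have "2 ^ M B \<le> a2 * log 2 (real B / real (A B))"
      by simp
    then show ?case
      using H a2(1) by (simp add: c_def c'_def H_def[symmetric] field_simps)
  qed
  have small: "eventually (\<lambda>B. (3 + log 2 C1) / 2 ^ M B +
      residual H h k1 k2 c0 (3 + log 2 C1) (log 2 (real B)) \<le> 2 * H * ((1 + k1) / k2) * c') sequentially"
  proof -
    have "(\<lambda>B. (3 + log 2 C1) / 2 ^ M B) \<longlonglongrightarrow> 0"
      by (intro tendsto_divide_0[OF tendsto_const] filterlim_at_top_imp_at_infinity pow_lim)
    moreover have "(\<lambda>B. residual H h k1 k2 c0 (3 + log 2 C1) (log 2 (real B))) \<longlonglongrightarrow> 0"
      using filterlim_compose[OF tendsto_residual x_lim] H h k1 k2 c0 by blast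
    ultimately have "(\<lambda>B. (3 + log 2 C1) / 2 ^ M B +
        residual H h k1 k2 c0 (3 + log 2 C1) (log 2 (real B))) \<longlonglongrightarrow> 0 + 0"
      by (rule tendsto_add)
    moreover have "0 + 0 < 2 * H * ((1 + k1) / k2) * c'"
      using H k1 k2 c' by simp
    ultimately have "eventually (\<lambda>B. (3 + log 2 C1) / 2 ^ M B +
      residual H h k1 k2 c0 (3 + log 2 C1) (log 2 (real B)) < 2 * H * ((1 + k1) / k2) * c') sequentially"
      by (rule order_tendstoD)
    then show ?thesis
      by eventually_elim simp
  qed
  have L_ge: "eventually (\<lambda>B. L B \<ge> 1) sequentially"
    using L_lim by (simp add: filterlim_at_top)
  have "eventually (\<lambda>B.
      measure_pmf.expectation (source_stream (A B) B \<delta> (P B)) (\<lambda>s. real (vld_length (M B) s))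
        \<le> (12 * exp (- c B) * (c B + 1) + 4 * H * ((1 + k1) / k2) * c B) * (real B * L B)) sequentially"
    using B0 A_le C1(2) c0(2) L_ge c_ge M_pos M_le small
  proof eventually_elim
    case (elim B)
    have "real l \<le> 2 * L B" if "l \<in> set_pmf (P B)" for l
      using P_supp[OF elim(1)] that by auto
    then show ?case
      using elim
      by (intro expected_vld_length_bound[OF delta(1) gamma k1 k2(1) c0(1) C1(1) H_def h_def elim(1)
          A_pos[OF elim(1)] elim(2) _ P_mean[OF elim(1)] elim(5) _ _ _ elim(6) c' elim(7,8,9)])
        (auto simp: c_def H_def)
  qed
  then show ?thesis
    by (intro exI[of _ "\<lambda>_. 0"]) (simp add: H_def)
qed

end
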